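(* Let $q$ be a complex number with $0<|q|<1$. Then the following four identities hold: $$\sum_{k=0}^\infty (-1)^k q^{k^2}\, \frac{[2k]_q\,([4k]_q-1)}{([2k]_q-1)^2} \cdot\frac{(q;q^2)_k^3}{(q^2;q^2)_k^3} = - \frac{(q;q^2)_\infty (q^3;q^2)_\infty}{(q^2;q^2)_\infty^2},$$ $$\sum_{k=0}^\infty (-1)^k q^{k^2+2k}\, \frac{[4k]_q-1}{([2k]_q-1)^3} \cdot\frac{(q;q^2)_k^3}{(q^2;q^2)_k^3}= \frac{(q;q^2)_\infty (q^3;q^2)_\infty}{(q^2;q^2)_\infty^2},$$ $$\sum_{k=0}^\infty \frac{P_k(q)\,q^{k^2}}{(1-q)^3 ([2k]_q-1)^2}\cdot \frac{(q;q^2)_k^2\, (q^2;q^4)_k} {(q^4;q^4)_k^3} = 2q(1+q)\,\frac{(q^2;q^4)_\infty (q^6;q^4)_\infty}{ (q^4;q^4)_\infty^2},$$ where $$P_k(q)=q^{12k+1}-3q^{10k+2}+3(2q^2-1)q^{8k+1}-(3q^4-1)q^{6k}+3q^{4k+1}-3q^{2k+2}+2q^3-q,$$ and $$q \sum_{k=0}^\infty \frac{[3k+4]_q}{[2k+3]_q^2} \cdot\frac{(q;q)_k^3\, (-q;q)_k} {(q^3;q^2)_k^3}\, q^{k(k+5)/2} = (1-q)^2\,\frac{(q^2;q^2)_\infty^4}{(q;q^2)_\infty^4}-1-q.$$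
   Context: For $n\in\{0,1,2,\ldots\}$, $[n]_q=\frac{1-q^n}{1-q}=\sum_{0\le k<n}q^k$ (so $[0]_q=0$). For complex $a$ and $q$ with $|q|<1$, $(a;q)_\infty=\prod_{j=0}^\infty(1-aq^j)$, and for $k\in\{0,1,2,\ldots\}$, $(a;q)_k=\prod_{j=0}^{k-1}(1-aq^j)$ (so $(a;q)_0=1$). The base may be a power of $q$: e.g. $(q;q^2)_k=\prod_{j=0}^{k-1}(1-q^{1+2j})$. An exponent on such a symbol denotes a power, e.g. $(q;q^2)_k^3=\big((q;q^2)_k\big)^3$ and $[2k+3]_q^2=([2k+3]_q)^2$. *)

theory Defs
  imports "HOL-Analysis.Analysis"
begin

definition q_number :: "nat \<Rightarrow> complex \<Rightarrow> complex" where
  "q_number n q = (1 - q ^ n) / (1 - q)"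

(* The base q is an explicit argument: (a;q)_k is q_poch a q k and (a;q^2)_k is q_poch a (q^2) k. *)

definition q_poch :: "complex \<Rightarrow> complex \<Rightarrow> nat \<Rightarrow> complex" where
  "q_poch a q k = (\<Prod>j<k. 1 - a * q ^ j)"

definition q_poch_inf :: "complex \<Rightarrow> complex \<Rightarrow> complex" where
  "q_poch_inf a q = (\<Prod>j. 1 - a * q ^ j)"

definition P_poly :: "nat \<Rightarrow> complex \<Rightarrow> complex" where
  "P_poly k q =
     q ^ (12*k + 1) - 3 * q ^ (10*k + 2) + 3 * (2 * q^2 - 1) * q ^ (8*k + 1)
     - (3 * q^4 - 1) * q ^ (6*k) + 3 * q ^ (4*k + 1) - 3 * q ^ (2*k + 2) + 2 * q^3 - q"

lemma q_number_eq_sum: "q \<noteq> 1 \<Longrightarrow> q_number n q = (\<Sum>k<n. q ^ k)"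
  by (simp add: q_number_def sum_gp_strict)

lemma has_prod_q_poch_inf:
  assumes "norm q < 1"
  shows "(\<lambda>j. 1 - a * q ^ j) has_prod q_poch_inf a q"
proof -
  have "summable (\<lambda>j. norm (1 - a * q ^ j - 1))"
    using assms by (simp add: norm_mult norm_power summable_mult summable_geometric)
  hence "convergent_prod (\<lambda>j. 1 - a * q ^ j)"
    by (intro abs_convergent_prod_imp_convergent_prod summable_imp_abs_convergent_prod)
  thus ?thesis
    unfolding q_poch_inf_def by (rule convergent_prod_has_prod)
qed

end

theory Submission
  imports Defs
begin

text \<open>
  Write \<open>x = q^k\<close>. Two parametric families of series are summed by WZ pairs in which the continuous
  parameter is multiplied by a power of \<open>q\<close>; since the parameter tends to \<open>0\<close> under iteration and
  the series then tends to \<open>1\<close>, each telescoping recurrence determines its sum.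

  The first family is the very-well-poised series \<open>6\<phi>5\<close> with the numerator parameters
  \<open>b, c, d\<close> replaced by their inverses \<open>B, C, E\<close>, so that the confluent case \<open>d \<rightarrow> \<infinity>\<close> is \<open>E = 0\<close>.
  In base \<open>q\<^sup>2\<close> it contains the first identity (\<open>a = q\<^sup>3\<close>, after dropping the vanishing term \<open>k = 0\<close>),
  the second one (\<open>a = 1/q\<close>), and the Lambert series of \<open>\<psi>(q)^4\<close> (\<open>a = q\<^sup>2\<close>), where
  \<open>\<psi>(q) = (q\<^sup>2;q\<^sup>2)/(q;q\<^sup>2)\<close>.

  The second family is a confluent quadratic summation in which the summation index is shifted by
  an arbitrary amount, encoded in \<open>u\<close>. If \<open>u\<^sup>2\<close> equals the base, the boundary term of the recurrence
  vanishes and the series is a product; the third identity differs from such a series by a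
  telescoping one. If \<open>u\<close> equals the base, the boundary terms add up to the Lambert series of
  \<open>\<psi>(q)^4\<close> without its first term, which is the last identity.
\<close>

section \<open>Shifted factorials: recurrences, limits and uniform bounds\<close>

lemma q_poch_0 [simp]: "q_poch a q 0 = 1"
  by (simp add: q_poch_def)

lemma q_poch_Suc: "q_poch a q (Suc k) = q_poch a q k * (1 - a * q ^ k)"
  by (simp add: q_poch_def)

lemma q_poch_add: "q_poch a q (n + k) = q_poch a q n * q_poch (a * q ^ n) q k"
  by (induction k) (simp_all add: q_poch_Suc power_add mult_ac)

lemma q_poch_Suc_left: "q_poch a q (Suc k) = (1 - a) * q_poch (a * q) q k"
  using q_poch_add[of a q 1 k] by (simp add: q_poch_Suc)

lemma q_poch_eq_0_iff: "q_poch a q k = 0 \<longleftrightarrow> (\<exists>j<k. a * q ^ j = 1)"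
  by (auto simp: q_poch_def)

lemma mult_power_neq_1_shift:
  fixes a q :: complex
  assumes "\<And>j. a * q ^ j \<noteq> 1"
  shows "a * q ^ n * q ^ j \<noteq> 1"
  using assms[of "n + j"] by (simp add: power_add mult.assoc)

lemma mult_power_neq_1:
  fixes a q :: complex
  assumes "norm a < 1" "norm q < 1"
  shows "a * q ^ j \<noteq> 1"
proof
  assume "a * q ^ j = 1"
  then have "norm a * norm q ^ j = 1"
    by (metis norm_mult norm_one norm_power)
  moreover have "norm a * norm q ^ j \<le> norm a * 1"
    using assms by (intro mult_left_mono power_le_one) auto
  ultimately show False
    using assms by simp
qed

lemma q_poch_tendsto:
  assumes "norm q < 1"
  shows "(\<lambda>k. q_poch a q k) \<longlonglongrightarrow> q_poch_inf a q"
  unfolding q_poch_def by (rule has_prod_imp_tendsto'[OF has_prod_q_poch_inf[OF assms]])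

lemma q_poch_inf_nonzero:
  assumes "norm q < 1" "\<And>j. a * q ^ j \<noteq> 1"
  shows "q_poch_inf a q \<noteq> 0"
  using has_prod_eq_0_iff[OF has_prod_q_poch_inf[OF assms(1), of a]] assms(2) by auto

lemma q_poch_inf_rec:
  assumes "norm q < 1"
  shows "q_poch_inf a q = (1 - a) * q_poch_inf (a * q) q"
proof (rule LIMSEQ_unique)
  show "(\<lambda>k. q_poch a q (Suc k)) \<longlonglongrightarrow> q_poch_inf a q"
    using q_poch_tendsto[OF assms] by (rule LIMSEQ_Suc)
  show "(\<lambda>k. q_poch a q (Suc k)) \<longlonglongrightarrow> (1 - a) * q_poch_inf (a * q) q"
    unfolding q_poch_Suc_left by (intro tendsto_intros q_poch_tendsto assms)
qed

text \<open>Each factor is at most 1 + |R| |q|^j in norm, so a single convergent product with real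
  base majorises all of them. Uniformity in \<open>z\<close> is what allows the parameter of a
  series to move.\<close>

lemma q_poch_bounded:
  assumes "norm q < 1"
  obtains M where "M > 0" "\<And>z k. norm z \<le> R \<Longrightarrow> norm (q_poch z q k) \<le> M"
proof -
  have "Bseq (\<lambda>k. q_poch (- of_real \<bar>R\<bar>) (of_real (norm q)) k)"
    by (rule convergent_imp_Bseq[OF convergentI[OF q_poch_tendsto]]) (use assms in simp)
  then obtain M where M: "M > 0" "\<And>k. norm (q_poch (- of_real \<bar>R\<bar>) (of_real (norm q)) k) \<le> M"
    by (auto elim!: BseqE)
  have "norm (q_poch z q k) \<le> M" if z: "norm z \<le> R" for z k
  proof -
    have "norm (q_poch z q k) = (\<Prod>j<k. norm (1 - z * q ^ j))"
      by (simp add: q_poch_def prod_norm)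
    also have "\<dots> \<le> (\<Prod>j<k. norm (1 - - of_real \<bar>R\<bar> * of_real (norm q) ^ j :: complex))"
    proof (intro prod_mono conjI)
      fix j
      have "norm (1 - z * q ^ j) \<le> 1 + norm z * norm q ^ j"
        by (metis norm_triangle_ineq4 norm_mult norm_one norm_power)
      also have "\<dots> \<le> 1 + \<bar>R\<bar> * norm q ^ j"
        using z by (intro add_left_mono mult_right_mono) auto
      also have "\<dots> = norm (of_real (1 + \<bar>R\<bar> * norm q ^ j) :: complex)"
        by (subst norm_of_real) simp
      also have "\<dots> = norm (1 - - of_real \<bar>R\<bar> * of_real (norm q) ^ j :: complex)"
        by simp
      finally show "norm (1 - z * q ^ j) \<le> norm (1 - - of_real \<bar>R\<bar> * of_real (norm q) ^ j :: complex)" .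
    qed simp
    also have "\<dots> = norm (q_poch (- of_real \<bar>R\<bar>) (of_real (norm q)) k)"
      by (simp add: q_poch_def prod_norm)
    finally show ?thesis
      using M(2)[of k] by linarith
  qed
  with M(1) show ?thesis by (rule that)
qed

text \<open>The shifted factorial is a quotient of two unshifted ones, (z;q)_(n+k) / (z;q)_n. Its
  inverse is therefore bounded in \<open>n\<close> and \<open>k\<close> at once: (z;q)_n is bounded,
  and 1/(z;q)_(n+k) converges because the infinite product does not vanish.\<close>

lemma q_poch_inverse_bounded:
  assumes "norm q < 1" and nz: "\<And>j. z * q ^ j \<noteq> 1"
  obtains M where "M > 0" "\<And>n k. norm (inverse (q_poch (z * q ^ n) q k)) \<le> M"
proof -
  have nz': "q_poch z q k \<noteq> 0" for k
    using nz by (auto simp: q_poch_eq_0_iff)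
  have "Bseq (\<lambda>k. inverse (q_poch z q k))"
    by (rule convergent_imp_Bseq[OF convergentI[OF tendsto_inverse[OF q_poch_tendsto q_poch_inf_nonzero]]])
      (use assms in auto)
  then obtain L where L: "L > 0" "\<And>k. norm (inverse (q_poch z q k)) \<le> L"
    by (auto elim!: BseqE)
  obtain M where M: "M > 0" "\<And>k. norm (q_poch z q k) \<le> M"
    using q_poch_bounded[OF assms(1), of "norm z"] by (metis order_refl)
  have "norm (inverse (q_poch (z * q ^ n) q k)) \<le> M * L" for n k
  proof -
    have "inverse (q_poch (z * q ^ n) q k) = q_poch z q n * inverse (q_poch z q (n + k))"
      using nz'[of n] by (simp add: q_poch_add)
    then show ?thesis
      unfolding norm_mult using mult_mono[OF M(2)[of n] L(2)[of "n + k"]] M(1)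
      by (simp add: norm_mult)
  qed
  with M(1) L(1) show ?thesis by (intro that[of "M * L"]) auto
qed

lemma summable_norm_of_ratio_limit:
  fixes w r :: "nat \<Rightarrow> complex"
  assumes "\<And>k. w (Suc k) = r k * w k" and "r \<longlonglongrightarrow> l" and "norm l < 1"
  shows "summable (\<lambda>k. norm (w k))"
proof -
  obtain c where c: "norm l < c" "c < 1"
    using dense[OF assms(3)] by blast
  have "eventually (\<lambda>k. norm (r k) < c) sequentially"
    using tendsto_norm[OF assms(2)] c(1) by (rule order_tendstoD)
  then obtain N where N: "\<And>k. k \<ge> N \<Longrightarrow> norm (r k) < c"
    by (auto simp: eventually_sequentially)
  show ?thesis
  proof (rule summable_ratio_test[OF c(2)])
    fix k assume "k \<ge> N"
    then show "norm (norm (w (Suc k))) \<le> c * norm (norm (w k))"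
      using N[of k] by (simp add: assms(1) norm_mult mult_right_mono)
  qed
qed

lemma summable_cmult_bound:
  fixes f w :: "nat \<Rightarrow> complex"
  assumes "summable (\<lambda>k. norm (w k))" "\<And>k. norm (f k) \<le> K * norm (w k)"
  shows "summable f"
  using summable_comparison_test'[OF summable_mult[OF assms(1), of K]] assms(2) by blast

section \<open>The very-well-poised family: WZ pair and product formula\<close>

text \<open>In terms of \<open>b = 1/B\<close>, \<open>c = 1/C\<close>, \<open>d = 1/E\<close> this is \<open>(b, c, d; q)\<^sub>k / (q; q)\<^sub>k * (aq/(bcd))^k\<close>.\<close>

definition vwp_weight :: "complex \<Rightarrow> complex \<Rightarrow> complex \<Rightarrow> complex \<Rightarrow> complex \<Rightarrow> nat \<Rightarrow> complex" where
  "vwp_weight a B C E q k = (\<Prod>j<k. (B - q^j) * (C - q^j) * (E - q^j) * (a * q) / (1 - q ^ Suc j))"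

definition vwp_coeff :: "complex \<Rightarrow> complex \<Rightarrow> complex \<Rightarrow> complex \<Rightarrow> complex \<Rightarrow> nat \<Rightarrow> complex" where
  "vwp_coeff a B C E q k = vwp_weight a B C E q k * q_poch a q k /
     (q_poch (a*q*B) q k * q_poch (a*q*C) q k * q_poch (a*q*E) q k)"

text \<open>This is 1 - a times the usual 6phi5 summand. Leaving out the normalising division by 1 -
  a makes the initial term 1 - a and keeps a = 1 harmless.\<close>

definition vwp_term :: "complex \<Rightarrow> complex \<Rightarrow> complex \<Rightarrow> complex \<Rightarrow> complex \<Rightarrow> nat \<Rightarrow> complex" where
  "vwp_term a B C E q k = (1 - a * q ^ (2*k)) * vwp_coeff a B C E q k"

lemma summable_vwp_weight:
  assumes "norm q < 1" and "norm (a * q * B * C * E) < 1"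
  shows "summable (\<lambda>k. norm (vwp_weight a B C E q k))"
proof (rule summable_norm_of_ratio_limit)
  show "vwp_weight a B C E q (Suc k) =
      (B - q^k) * (C - q^k) * (E - q^k) * (a * q) / (1 - q ^ Suc k) * vwp_weight a B C E q k" for k
    by (simp add: vwp_weight_def mult.commute)
  have "(\<lambda>k. (B - q^k) * (C - q^k) * (E - q^k) * (a * q) / (1 - q ^ Suc k))
      \<longlonglongrightarrow> (B - 0) * (C - 0) * (E - 0) * (a * q) / (1 - 0)"
    using assms(1) by (intro tendsto_intros LIMSEQ_power_zero LIMSEQ_Suc[OF LIMSEQ_power_zero]) auto
  then show "(\<lambda>k. (B - q^k) * (C - q^k) * (E - q^k) * (a * q) / (1 - q ^ Suc k)) \<longlonglongrightarrow> a * q * B * C * E"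
    by (simp add: mult_ac)
qed (use assms in auto)

lemma vwp_weight_shift: "vwp_weight (a * q ^ n) B C E q k = q ^ (n * k) * vwp_weight a B C E q k"
  by (induction k) (simp_all add: vwp_weight_def power_add mult_ac)

text \<open>Replacing a by a q^n multiplies the weight by q^(nk), while the shifted factorials stay
  uniformly bounded. The estimate has the shape required by
  \<open>suminf_minus_first_tendsto_0\<close>.\<close>

lemma vwp_coeff_bound:
  assumes q: "norm q < 1" and
    nz: "\<And>j. a * q * B * q ^ j \<noteq> 1" "\<And>j. a * q * C * q ^ j \<noteq> 1" "\<And>j. a * q * E * q ^ j \<noteq> 1"
  obtains K where "K > 0"
    "\<And>n k. norm (vwp_coeff (a * q ^ n) B C E q k) \<le> K * norm q ^ (n * k) * norm (vwp_weight a B C E q k)"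
proof -
  obtain M where M: "M > 0" "\<And>z k. norm z \<le> norm a \<Longrightarrow> norm (q_poch z q k) \<le> M"
    using q_poch_bounded[OF q] by metis
  obtain L1 where L1: "L1 > 0" "\<And>n k. norm (inverse (q_poch (a*q*B * q ^ n) q k)) \<le> L1"
    using q_poch_inverse_bounded[OF q nz(1)] by metis
  obtain L2 where L2: "L2 > 0" "\<And>n k. norm (inverse (q_poch (a*q*C * q ^ n) q k)) \<le> L2"
    using q_poch_inverse_bounded[OF q nz(2)] by metis
  obtain L3 where L3: "L3 > 0" "\<And>n k. norm (inverse (q_poch (a*q*E * q ^ n) q k)) \<le> L3"
    using q_poch_inverse_bounded[OF q nz(3)] by metis
  have "norm (vwp_coeff (a * q ^ n) B C E q k)
      \<le> (M * L1 * L2 * L3) * norm q ^ (n * k) * norm (vwp_weight a B C E q k)" for n k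
  proof -
    have eq: "vwp_coeff (a * q ^ n) B C E q k = q_poch (a * q ^ n) q k *
        inverse (q_poch (a*q*B * q ^ n) q k) * inverse (q_poch (a*q*C * q ^ n) q k) *
        inverse (q_poch (a*q*E * q ^ n) q k) * (q ^ (n * k) * vwp_weight a B C E q k)"
      unfolding vwp_coeff_def vwp_weight_shift by (simp add: field_simps)
    have le: "norm (a * q ^ n) \<le> norm a"
      using q by (simp add: norm_mult norm_power mult_left_le power_le_one)
    have "norm (vwp_coeff (a * q ^ n) B C E q k) = norm (q_poch (a * q ^ n) q k) *
        norm (inverse (q_poch (a*q*B * q ^ n) q k)) * norm (inverse (q_poch (a*q*C * q ^ n) q k)) *
        norm (inverse (q_poch (a*q*E * q ^ n) q k)) * norm (q ^ (n * k) * vwp_weight a B C E q k)"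
      unfolding eq by (simp only: norm_mult)
    also have "\<dots> \<le> (M * L1 * L2 * L3) * norm (q ^ (n * k) * vwp_weight a B C E q k)"
      using M(1) L1(1) L2(1) L3(1)
      by (intro mult_right_mono mult_mono[OF mult_mono[OF mult_mono]] M(2)[OF le] L1(2) L2(2) L3(2)) simp_all
    finally have "norm (vwp_coeff (a * q ^ n) B C E q k)
        \<le> (M * L1 * L2 * L3) * norm (q ^ (n * k) * vwp_weight a B C E q k)" .
    then show ?thesis by (simp add: norm_mult norm_power mult.assoc)
  qed
  then show ?thesis using M(1) L1(1) L2(1) L3(1) by (intro that[of "M * L1 * L2 * L3"]) auto
qed

text \<open>The WZ equation for the step from a to a q, with x = q^k, after division by the common
  coefficient and clearing of denominators.\<close>

lemma vwp_telescope_polynomial: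
  fixes a q B C E x :: complex
  shows "(1 - a*q*B*C*E) * (1 - a*x^2) * ((1 - a*q*B*x) * (1 - a*q*C*x) * (1 - a*q*E*x))
      - (1 - a*q*x^2) * (1 - a*x) * x * ((1 - a*q*B*C) * (1 - a*q*B*E) * (1 - a*q*C*E))
    = (1 - x) * ((1 - a*q*B*x) * (1 - a*q*C*x) * (1 - a*q*E*x)) * (1 - a^2*q*B*C*E*x)
      - (1 - a*x) * ((B - x) * (C - x) * (E - x)) * (a*q) * (1 - a^2*q*B*C*E*(q*x))"
  by algebra


lemma q_poch_shift: "(1 - a) * q_poch (a * q) q k = q_poch a q k * (1 - a * q ^ k)"
  using q_poch_Suc_left[of a q k] by (simp add: q_poch_Suc)

text \<open>\<open>H\<close> is the WZ partner of the summand. Both a -> a q and k -> k + 1 multiply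
  \<open>vwp_coeff\<close> by a rational function of x = q^k, so multiplying by \<open>P\<close>
  reduces the claim to \<open>vwp_telescope_polynomial\<close>. The factor 1 - q^k makes
  \<open>H\<close> vanish at k = 0.\<close>

lemma vwp_term_telescope:
  fixes a q B C E :: complex and k :: nat
  defines "H \<equiv> \<lambda>k. vwp_coeff a B C E q k * (1 - q^k) * (1 - a^2*q*B*C*E * q^k)"
  assumes q: "norm q < 1" and
    nz: "\<And>j. a * q * B * q ^ j \<noteq> 1" "\<And>j. a * q * C * q ^ j \<noteq> 1" "\<And>j. a * q * E * q ^ j \<noteq> 1"
  shows "(1 - a*q*B*C*E) * vwp_term a B C E q k
      - (1 - a) * (1 - a*q*B*C) * (1 - a*q*B*E) * (1 - a*q*C*E)
        / ((1 - a*q*B) * (1 - a*q*C) * (1 - a*q*E)) * vwp_term (a*q) B C E q k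
    = H k - H (Suc k)"
proof -
  define x where "x = q ^ k"
  define h where "h = vwp_coeff a B C E q k"
  define P where "P = (1 - a*q*B*x) * (1 - a*q*C*x) * (1 - a*q*E*x)"
  define M where "M = (1 - a*q*B) * (1 - a*q*C) * (1 - a*q*E)"
  define L where "L = (1 - a*q*B*C) * (1 - a*q*B*E) * (1 - a*q*C*E)"
  have P0: "P \<noteq> 0"
    using nz[of k] by (simp add: P_def x_def)
  have M0: "M \<noteq> 0"
    using nz[of 0] by (simp add: M_def)
  have qx: "1 - q * x \<noteq> 0"
    using mult_power_neq_1[OF q q, of k] by (simp add: x_def)
  \<comment> \<open>Effect of k -> k + 1 on the coefficient. The factor 1 - q x from the weight is
    the one that \<open>H\<close> carries at k + 1.\<close>
  have hS: "vwp_coeff a B C E q (Suc k) * (1 - q*x) * P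
      = h * ((1 - a*x) * ((B - x) * (C - x) * (E - x)) * (a*q))"
    using P0 qx unfolding h_def vwp_coeff_def P_def x_def
    by (simp add: q_poch_Suc vwp_weight_def) (simp add: divide_simps)
  have sh: "(1 - z) / q_poch z q k = (1 - z * x) / q_poch (z*q) q k"
    if "\<And>j. z * q ^ j \<noteq> 1" for z
  proof -
    have "q_poch z q k \<noteq> 0" "q_poch (z*q) q k \<noteq> 0"
      using that mult_power_neq_1_shift[of z q 1] by (auto simp: q_poch_eq_0_iff)
    then show ?thesis
      using q_poch_shift[of z q k] by (simp add: field_simps x_def)
  qed
  \<comment> \<open>Effect of a -> a q: the weight contributes x, and each shifted factorial
    exchanges its first factor for a new last one.\<close>
  have "(1 - a) * vwp_coeff (a*q) B C E q k * P
      = x * vwp_weight a B C E q k * ((1 - a) * q_poch (a*q) q k)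
        * ((1 - a*q*B*x) / q_poch (a*q*B*q) q k) * ((1 - a*q*C*x) / q_poch (a*q*C*q) q k)
        * ((1 - a*q*E*x) / q_poch (a*q*E*q) q k)"
    using vwp_weight_shift[of a q 1 B C E k] unfolding vwp_coeff_def P_def x_def
    by (simp add: mult_ac)
  also have "\<dots> = h * ((1 - a*x) * x * M)"
    unfolding q_poch_shift sh[OF nz(1), symmetric] sh[OF nz(2), symmetric] sh[OF nz(3), symmetric]
    unfolding h_def vwp_coeff_def M_def x_def by (simp add: mult_ac)
  finally have hq: "(1 - a) * vwp_coeff (a*q) B C E q k * P = h * ((1 - a*x) * x * M)" .
  define R where "R = L / M"
  define h' where "h' = vwp_coeff (a*q) B C E q k"
  have "((1 - a*q*B*C*E) * vwp_term a B C E q k - (1 - a) * R * vwp_term (a*q) B C E q k) * P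
    = ((1 - a*q*B*C*E) * ((1 - a*x^2) * h) - (1 - a) * R * ((1 - a*q*x^2) * h')) * P"
    by (simp add: vwp_term_def h_def h'_def x_def power_even_eq)
  also have "\<dots> = (1 - a*q*B*C*E) * (1 - a*x^2) * P * h - (1 - a*q*x^2) * R * ((1 - a) * h' * P)"
    by algebra
  also have "\<dots> = (1 - a*q*B*C*E) * (1 - a*x^2) * P * h - (1 - a*q*x^2) * h * (1 - a*x) * x * (R * M)"
    unfolding hq[folded h'_def] by algebra
  also have "R * M = L"
    using M0 by (simp add: R_def)
  also have "(1 - a*q*B*C*E) * (1 - a*x^2) * P * h - (1 - a*q*x^2) * h * (1 - a*x) * x * L
      = h * ((1 - a*q*B*C*E) * (1 - a*x^2) * P - (1 - a*q*x^2) * (1 - a*x) * x * L)"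
    by algebra
  also have "\<dots> = h * ((1 - x) * P * (1 - a^2*q*B*C*E*x)
      - (1 - a*x) * ((B - x) * (C - x) * (E - x)) * (a*q) * (1 - a^2*q*B*C*E*(q*x)))"
    unfolding P_def L_def vwp_telescope_polynomial ..
  also have "\<dots> = h * (1 - x) * (1 - a^2*q*B*C*E*x) * P
      - h * ((1 - a*x) * ((B - x) * (C - x) * (E - x)) * (a*q)) * (1 - a^2*q*B*C*E*(q*x))"
    by (simp add: algebra_simps)
  also have "\<dots> = (H k - H (Suc k)) * P"
  proof -
    have "H k = h * (1 - x) * (1 - a^2*q*B*C*E*x)"
      and "H (Suc k) = vwp_coeff a B C E q (Suc k) * (1 - q*x) * (1 - a^2*q*B*C*E*(q*x))"
      by (simp_all add: H_def h_def x_def)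
    then show ?thesis
      unfolding hS[symmetric] by algebra
  qed
  finally show ?thesis
    using P0 by (simp add: R_def L_def M_def mult.assoc)
qed

text \<open>For k >= 1 the factor t^(nk) is at most t^n, so everything beyond the initial term is
  O(t^n). Thus the limit of the sums along the iteration can be read off the term k = 0.\<close>

lemma suminf_minus_first_tendsto_0:
  fixes f :: "nat \<Rightarrow> nat \<Rightarrow> complex"
  assumes t: "0 \<le> t" "t < 1" and w: "summable (\<lambda>k. norm (w k :: complex))"
    and f: "\<And>n k. norm (f n k) \<le> K * t ^ (n * k) * norm (w k)"
  shows "\<And>n. summable (f n)" and "(\<lambda>n. (\<Sum>k. f n k) - f n 0) \<longlonglongrightarrow> 0"
proof -
  have f': "norm (f n k) \<le> \<bar>K\<bar> * t ^ (n * k) * norm (w k)" for n k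
    by (rule order_trans[OF f]) (intro mult_right_mono, use t in auto)
  show sf: "summable (f n)" for n
  proof (rule summable_cmult_bound[OF w])
    show "norm (f n k) \<le> \<bar>K\<bar> * norm (w k)" for k
      using f'[of n k] t by (smt (verit) mult_left_le mult_right_mono norm_ge_zero power_le_one abs_ge_zero)
  qed
  have w': "summable (\<lambda>k. \<bar>K\<bar> * t ^ n * norm (w (Suc k)))" for n
    using w by (intro summable_mult) (subst summable_Suc_iff)
  have bound: "norm ((\<Sum>k. f n k) - f n 0) \<le> (\<bar>K\<bar> * (\<Sum>k. norm (w (Suc k)))) * t ^ n" for n
  proof -
    have le: "norm (f n (Suc k)) \<le> \<bar>K\<bar> * t ^ n * norm (w (Suc k))" for k
    proof -
      have "t ^ (n * Suc k) \<le> t ^ n"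
        using t by (intro power_decreasing) auto
      then have "\<bar>K\<bar> * t ^ (n * Suc k) * norm (w (Suc k)) \<le> \<bar>K\<bar> * t ^ n * norm (w (Suc k))"
        by (intro mult_right_mono mult_left_mono) auto
      then show ?thesis
        using f'[of n "Suc k"] by linarith
    qed
    have "norm ((\<Sum>k. f n k) - f n 0) = norm (\<Sum>k. f n (Suc k))"
      using suminf_split_head[OF sf[of n]] by simp
    also have "\<dots> \<le> (\<Sum>k. \<bar>K\<bar> * t ^ n * norm (w (Suc k)))"
      by (rule norm_suminf_le[OF le w'])
    also have "\<dots> = (\<bar>K\<bar> * (\<Sum>k. norm (w (Suc k)))) * t ^ n"
      using summable_Suc_iff[of "\<lambda>k. norm (w k)"] w by (subst suminf_mult) auto
    finally show ?thesis .
  qed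
  have "(\<lambda>n. (\<bar>K\<bar> * (\<Sum>k. norm (w (Suc k)))) * t ^ n) \<longlonglongrightarrow> (\<bar>K\<bar> * (\<Sum>k. norm (w (Suc k)))) * 0"
    using t by (intro tendsto_intros LIMSEQ_power_zero) auto
  then show "(\<lambda>n. (\<Sum>k. f n k) - f n 0) \<longlonglongrightarrow> 0"
    by (intro Lim_null_comparison[OF always_eventually[OF allI[OF bound]]]) simp
qed

text \<open>The nonterminating 6phi5 summation. The recurrence from a to a q is iterated; the finite
  products converge to the infinite ones and the remaining series tends to 1, as its initial term is
  1 - a q^n.\<close>

lemma vwp_sums:
  assumes q: "norm q < 1" and abcd: "norm (a*q*B*C*E) < 1" and
    nz: "\<And>j. a * q * B * q ^ j \<noteq> 1" "\<And>j. a * q * C * q ^ j \<noteq> 1" "\<And>j. a * q * E * q ^ j \<noteq> 1"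
  shows "vwp_term a B C E q sums
    (q_poch_inf a q * q_poch_inf (a*q*B*C) q * q_poch_inf (a*q*B*E) q * q_poch_inf (a*q*C*E) q /
      (q_poch_inf (a*q*B) q * q_poch_inf (a*q*C) q * q_poch_inf (a*q*E) q * q_poch_inf (a*q*B*C*E) q))"
proof -
  note w = summable_vwp_weight[OF q abcd]
  have nz4: "a*q*B*C*E * q ^ j \<noteq> 1" for j
    by (rule mult_power_neq_1[OF abcd q])
  obtain K where K: "K > 0" "\<And>n k. norm (vwp_coeff (a * q ^ n) B C E q k)
      \<le> K * norm q ^ (n * k) * norm (vwp_weight a B C E q k)"
    using vwp_coeff_bound[OF q nz] by metis
  have bnd: "norm (vwp_term (a * q ^ n) B C E q k)
      \<le> ((1 + norm a) * K) * norm q ^ (n * k) * norm (vwp_weight a B C E q k)" for n k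
  proof -
    have "norm q ^ n * norm q ^ (2*k) \<le> 1"
      using q by (intro mult_le_one power_le_one) auto
    then have "norm (a * q ^ n * q ^ (2*k)) \<le> norm a"
      by (simp add: norm_mult norm_power mult.assoc mult_left_le)
    then have "norm (1 - a * q ^ n * q ^ (2*k)) \<le> 1 + norm a"
      using norm_triangle_ineq4[of 1 "a * q ^ n * q ^ (2*k)"] by simp
    from mult_mono[OF this K(2)[of n k]] show ?thesis
      by (simp add: vwp_term_def norm_mult mult.assoc)
  qed
  define S where "S n = (\<Sum>k. vwp_term (a * q ^ n) B C E q k)" for n
  note tends = suminf_minus_first_tendsto_0[OF norm_ge_zero q w bnd]
  have summ: "summable (vwp_term (a * q ^ n) B C E q)" for n
    by (rule tends(1))
  have lim0: "(\<lambda>n. S n - vwp_term (a * q ^ n) B C E q 0) \<longlonglongrightarrow> 0"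
    unfolding S_def by (rule tends(2))
  have "(\<lambda>n. (S n - vwp_term (a * q ^ n) B C E q 0) + (1 - a * q ^ n)) \<longlonglongrightarrow> 0 + (1 - a * 0)"
    using q by (intro tendsto_intros lim0 LIMSEQ_power_zero)
  then have S1: "S \<longlonglongrightarrow> 1"
    by (simp add: vwp_term_def vwp_coeff_def vwp_weight_def)
  \<comment> \<open>\<open>H\<close> vanishes at 0 by its factor 1 - q^k, and at infinity because
    the coefficients are summable. The telescoped sum is therefore 0 and the recurrence is
    homogeneous.\<close>
  have step: "(1 - a*q^n*q*B*C*E) * ((1 - a*q^n*q*B) * (1 - a*q^n*q*C) * (1 - a*q^n*q*E)) * S n
      = (1 - a*q^n) * (1 - a*q^n*q*B*C) * (1 - a*q^n*q*B*E) * (1 - a*q^n*q*C*E) * S (Suc n)" for n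
  proof -
    define b where "b = a * q ^ n"
    define M where "M = (1 - b*q*B) * (1 - b*q*C) * (1 - b*q*E)"
    define L where "L = (1 - b) * (1 - b*q*B*C) * (1 - b*q*B*E) * (1 - b*q*C*E)"
    have nzb: "b * q * B * q ^ j \<noteq> 1" "b * q * C * q ^ j \<noteq> 1" "b * q * E * q ^ j \<noteq> 1" for j
      using nz[of "n + j"] by (simp_all add: b_def power_add mult_ac)
    define H where "H k = vwp_coeff b B C E q k * (1 - q^k) * (1 - b^2*q*B*C*E * q^k)" for k
    have "summable (\<lambda>k. vwp_coeff b B C E q k)"
    proof (rule summable_cmult_bound[OF w])
      have "norm q ^ (n * k) \<le> 1" for k
        using q by (intro power_le_one) auto
      then show "norm (vwp_coeff b B C E q k) \<le> K * norm (vwp_weight a B C E q k)" for k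
        using K(2)[of n k] K(1) unfolding b_def
        by (smt (verit) mult_left_le mult_right_mono norm_ge_zero)
    qed
    then have c0: "vwp_coeff b B C E q \<longlonglongrightarrow> 0"
      by (rule summable_LIMSEQ_zero)
    have "H \<longlonglongrightarrow> 0 * (1 - 0) * (1 - b^2*q*B*C*E * 0)"
      unfolding H_def using q by (intro tendsto_intros c0 LIMSEQ_power_zero)
    then have "(\<lambda>k. H k - H (Suc k)) sums (H 0 - 0)"
      by (intro telescope_sums') simp
    moreover have "(\<lambda>k. H k - H (Suc k)) sums ((1 - b*q*B*C*E) * S n - L / M * S (Suc n))"
      unfolding H_def vwp_term_telescope[OF q nzb, symmetric] L_def M_def S_def
      using summ[of n] summ[of "Suc n"]
      by (intro sums_diff sums_mult summable_sums) (auto simp: b_def mult_ac)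
    ultimately have "(1 - b*q*B*C*E) * S n - L / M * S (Suc n) = 0"
      using sums_unique2 by (fastforce simp: H_def)
    moreover have "M \<noteq> 0"
      using nzb[of 0] by (simp add: M_def)
    ultimately show ?thesis
      unfolding L_def M_def b_def by (simp add: field_simps)
  qed
  define N where "N n = q_poch a q n * q_poch (a*q*B*C) q n * q_poch (a*q*B*E) q n * q_poch (a*q*C*E) q n" for n
  define D where "D n = q_poch (a*q*B) q n * q_poch (a*q*C) q n * q_poch (a*q*E) q n * q_poch (a*q*B*C*E) q n" for n
  \<comment> \<open>Kept free of division: factors of \<open>N n\<close> may be zero, whereas the
    limit of \<open>D n\<close> is shown to be nonzero before dividing.\<close>
  have iter: "D n * S 0 = N n * S n" for n
  proof (induction n)
    case (Suc n)
    have "D (Suc n) * S 0 = (D n * S 0) * ((1 - a*q^n*q*B*C*E) * ((1 - a*q^n*q*B) * (1 - a*q^n*q*C) * (1 - a*q^n*q*E)))"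
      by (simp add: D_def q_poch_Suc mult_ac)
    also have "\<dots> = N n * ((1 - a*q^n*q*B*C*E) * ((1 - a*q^n*q*B) * (1 - a*q^n*q*C) * (1 - a*q^n*q*E)) * S n)"
      unfolding Suc.IH by (simp only: mult_ac)
    also have "\<dots> = N (Suc n) * S (Suc n)"
      unfolding step by (simp add: N_def q_poch_Suc mult_ac)
    finally show ?case .
  qed (simp add: D_def N_def)
  let ?N = "q_poch_inf a q * q_poch_inf (a*q*B*C) q * q_poch_inf (a*q*B*E) q * q_poch_inf (a*q*C*E) q"
  let ?D = "q_poch_inf (a*q*B) q * q_poch_inf (a*q*C) q * q_poch_inf (a*q*E) q * q_poch_inf (a*q*B*C*E) q"
  have "(\<lambda>n. D n * S 0) \<longlonglongrightarrow> ?D * S 0"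
    unfolding D_def by (intro tendsto_intros q_poch_tendsto q)
  moreover have "(\<lambda>n. D n * S 0) \<longlonglongrightarrow> ?N * 1"
    unfolding iter N_def by (intro tendsto_mult q_poch_tendsto q S1)
  ultimately have "?D * S 0 = ?N"
    using LIMSEQ_unique by fastforce
  moreover have "?D \<noteq> 0"
    using q_poch_inf_nonzero[OF q] nz nz4 by simp
  ultimately have "S 0 = ?N / ?D"
    by (simp add: field_simps)
  then show ?thesis
    using summable_sums[OF summ[of 0]] by (simp add: S_def)
qed

section \<open>The confluent quadratic family: WZ pair, product case and Lambert case\<close>

definition quad_weight :: "complex \<Rightarrow> complex \<Rightarrow> nat \<Rightarrow> complex" where
  "quad_weight A q k = (\<Prod>j<k. A * q ^ j)"

definition quad_coeff :: "complex \<Rightarrow> complex \<Rightarrow> complex \<Rightarrow> nat \<Rightarrow> complex" where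
  "quad_coeff A u q k = quad_weight A q k * q_poch u q k ^ 2 * q_poch (u^2) (q^2) k /
     (q_poch (u^2*q) (q^2) k * q_poch (A*u*q) (q^2) k ^ 2)"

text \<open>The exponent meant is 3k - 1; dividing by \<open>q\<close> avoids truncated subtraction
  at k = 0.\<close>

definition quad_term :: "complex \<Rightarrow> complex \<Rightarrow> complex \<Rightarrow> nat \<Rightarrow> complex" where
  "quad_term A u q k = (1 - A * u^2 * q ^ (3*k) / q) * quad_coeff A u q k"

lemma summable_quad_weight:
  assumes "norm q < 1"
  shows "summable (\<lambda>k. norm (quad_weight A q k))"
proof (rule summable_norm_of_ratio_limit)
  show "quad_weight A q (Suc k) = A * q ^ k * quad_weight A q k" for k
    by (simp add: quad_weight_def mult.commute)
  show "(\<lambda>k. A * q ^ k) \<longlonglongrightarrow> A * 0"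
    by (intro tendsto_intros LIMSEQ_power_zero assms)
qed simp

lemma quad_weight_shift: "quad_weight (A * c ^ n) q k = c ^ (n * k) * quad_weight A q k"
  by (induction k) (simp_all add: quad_weight_def power_add mult_ac)

lemma norm_power2_less_1:
  fixes q :: complex
  assumes "norm q < 1"
  shows "norm (q\<^sup>2) < 1"
  using assms by (simp add: norm_power power_less_one_iff)

text \<open>Here the moving parameter is \<open>A\<close>, multiplied by q^2 at each step with
  \<open>u\<close> fixed; the weight supplies q^(2nk).\<close>

lemma quad_coeff_bound:
  assumes q: "norm q < 1" and
    nz: "\<And>j. u^2 * q * (q^2) ^ j \<noteq> 1" "\<And>j. A * u * q * (q^2) ^ j \<noteq> 1"
  obtains K where "K > 0"
    "\<And>n k. norm (quad_coeff (A * (q^2) ^ n) u q k) \<le> K * norm (q^2) ^ (n * k) * norm (quad_weight A q k)"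
proof -
  note q2 = norm_power2_less_1[OF q]
  obtain M where M: "M > 0" "\<And>k. norm (q_poch u q k) \<le> M"
    using q_poch_bounded[OF q, of "norm u"] by (metis order_refl)
  obtain M' where M': "M' > 0" "\<And>k. norm (q_poch (u^2) (q^2) k) \<le> M'"
    using q_poch_bounded[OF q2, of "norm (u^2)"] by (metis order_refl)
  obtain L where L: "L > 0" "\<And>n k. norm (inverse (q_poch (u^2*q * (q^2) ^ n) (q^2) k)) \<le> L"
    using q_poch_inverse_bounded[OF q2 nz(1)] by metis
  obtain L' where L': "L' > 0" "\<And>n k. norm (inverse (q_poch (A*u*q * (q^2) ^ n) (q^2) k)) \<le> L'"
    using q_poch_inverse_bounded[OF q2 nz(2)] by metis
  have "norm (quad_coeff (A * (q^2) ^ n) u q k)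
      \<le> (M ^ 2 * M' * L * L' ^ 2) * norm (q^2) ^ (n * k) * norm (quad_weight A q k)" for n k
  proof -
    \<comment> \<open>The denominator with u^2 q does not move with \<open>n\<close>, so its bound
      is used at shift 0.\<close>
    have eq: "quad_coeff (A * (q^2) ^ n) u q k = q_poch u q k ^ 2 * q_poch (u^2) (q^2) k *
        inverse (q_poch (u^2*q * (q^2) ^ 0) (q^2) k) *
        inverse (q_poch (A*u*q * (q^2) ^ n) (q^2) k) ^ 2 * ((q^2) ^ (n * k) * quad_weight A q k)"
      unfolding quad_coeff_def quad_weight_shift by (simp add: divide_inverse power_inverse mult_ac)
    have "norm (quad_coeff (A * (q^2) ^ n) u q k) = norm (q_poch u q k) ^ 2 * norm (q_poch (u^2) (q^2) k) *
        norm (inverse (q_poch (u^2*q * (q^2) ^ 0) (q^2) k)) *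
        norm (inverse (q_poch (A*u*q * (q^2) ^ n) (q^2) k)) ^ 2 * norm ((q^2) ^ (n * k) * quad_weight A q k)"
      unfolding eq by (simp only: norm_mult norm_power)
    also have "\<dots> \<le> (M ^ 2 * M' * L * L' ^ 2) * norm ((q^2) ^ (n * k) * quad_weight A q k)"
      using M(1) M'(1) L(1) L'(1)
      by (intro mult_right_mono mult_mono[OF mult_mono[OF mult_mono]] power_mono M(2) M'(2) L(2) L'(2)) simp_all
    finally show ?thesis
      by (simp only: norm_mult norm_power mult.assoc)
  qed
  then show ?thesis using M(1) M'(1) L(1) L'(1) by (intro that[of "M ^ 2 * M' * L * L' ^ 2"]) simp_all
qed

text \<open>The cleared WZ equation for the step from A to A q^2, again with x = q^k.\<close>

lemma quad_telescope_polynomial: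
  fixes A u q x :: complex
  shows "(q - A*u^2*x^3) * (1 - A*u*q*x^2)^2 - (u - A*q)^2 * (1 - A*u^2*x^3*q) * x^2
    = (q - u^2*x^2) * (1 + A*x) * (1 - A*u*q*x^2)^2
      - (1 - u*x)^2 * (1 - u^2*x^2) * (A*x) * q * (1 + A*q*x)"
  by algebra

text \<open>The ratios of \<open>quad_coeff\<close> under A -> A q^2 and k -> k + 1 are rational in
  x = q^k; multiplying by q P^2 leaves \<open>quad_telescope_polynomial\<close>. This partner
  \<open>H\<close> need not vanish at k = 0: its value there contains 1 - u^2/q.\<close>

lemma quad_term_telescope:
  fixes A u q :: complex and k :: nat
  defines "H \<equiv> \<lambda>k. (1 - A*u*q)^2 * quad_coeff A u q k * (1 - u^2 * (q^k)^2 / q) * (1 + A * q^k)"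
  assumes q0: "q \<noteq> 0" and
    nz: "\<And>j. u^2 * q * (q^2) ^ j \<noteq> 1" "\<And>j. A * u * q * (q^2) ^ j \<noteq> 1"
  shows "(1 - A*u*q)^2 * quad_term A u q k - (u - A*q)^2 / q * quad_term (A*q^2) u q k
    = H k - H (Suc k)"
proof -
  define x where "x = q ^ k"
  define h where "h = quad_coeff A u q k"
  define h' where "h' = quad_coeff (A*q^2) u q k"
  define P where "P = 1 - A*u*q*x^2"
  define M where "M = 1 - A*u*q"
  have x2: "(q^2) ^ k = x^2"
    by (simp add: x_def mult.commute flip: power_mult)
  have P0: "P \<noteq> 0" and Q0: "1 - u^2*q*x^2 \<noteq> 0"
    using nz[of k] by (simp_all add: P_def x2)
  have "q_poch (A*u*q*q^2) (q^2) k \<noteq> 0" "q_poch (A*u*q) (q^2) k \<noteq> 0"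
    using nz(2) mult_power_neq_1_shift[of "A*u*q" "q^2" 1] by (auto simp: q_poch_eq_0_iff)
  moreover have "M * q_poch (A*u*q*q^2) (q^2) k = q_poch (A*u*q) (q^2) k * P"
    using q_poch_shift[of "A*u*q" "q^2" k] by (simp add: M_def P_def x2)
  ultimately have sh: "P / q_poch (A*u*q*q^2) (q^2) k = M / q_poch (A*u*q) (q^2) k"
    by (simp add: field_simps)
  have "h' * P^2 = x^2 * (quad_weight A q k * q_poch u q k ^ 2 * q_poch (u^2) (q^2) k / q_poch (u^2*q) (q^2) k)
      * (P / q_poch (A*u*q*q^2) (q^2) k)^2"
    using quad_weight_shift[of A "q^2" 1 q k]
    by (simp add: h'_def quad_coeff_def x2 power_divide mult_ac)
  then have hq: "h' * P^2 = h * x^2 * M^2"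
    unfolding sh h_def quad_coeff_def by (simp add: power_divide mult_ac)
  have hS: "quad_coeff A u q (Suc k) * (1 - u^2*q*x^2) * P^2
      = h * ((1 - u*x)^2 * (1 - u^2*x^2) * (A*x))"
  proof -
    have "quad_coeff A u q (Suc k) = h * ((1 - u*x)^2 * (1 - u^2*x^2) * (A*x)) / ((1 - u^2*q*x^2) * P^2)"
      unfolding h_def quad_coeff_def P_def
      by (simp add: q_poch_Suc quad_weight_def x2 power_mult_distrib mult_ac flip: x_def)
    then show ?thesis
      using P0 Q0 by simp
  qed
  have x3: "q ^ (3*k) = x^3"
    by (simp add: x_def mult.commute flip: power_mult)
  have t: "q * quad_term A u q k = (q - A*u^2*x^3) * h"
    and t': "quad_term (A*q^2) u q k = (1 - A*u^2*x^3*q) * h'"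
    using q0 by (simp_all add: quad_term_def h_def h'_def x3 right_diff_distrib left_diff_distrib
        power2_eq_square)
  have "(M^2 * quad_term A u q k - (u - A*q)^2 / q * quad_term (A*q^2) u q k) * (q * P^2)
      = M^2 * (q * quad_term A u q k) * P^2 - (u - A*q)^2 * quad_term (A*q^2) u q k * P^2"
    using q0 by (simp add: right_diff_distrib left_diff_distrib)
  also have "\<dots> = M^2 * ((q - A*u^2*x^3) * h) * P^2 - (u - A*q)^2 * ((1 - A*u^2*x^3*q) * (h' * P^2))"
    unfolding t t' by algebra
  also have "\<dots> = M^2 * h * ((q - A*u^2*x^3) * P^2 - (u - A*q)^2 * (1 - A*u^2*x^3*q) * x^2)"
    unfolding hq by algebra
  also have "\<dots> = M^2 * h * ((q - u^2*x^2) * (1 + A*x) * P^2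
      - (1 - u*x)^2 * (1 - u^2*x^2) * (A*x) * q * (1 + A*q*x))"
    unfolding P_def quad_telescope_polynomial ..
  also have "\<dots> = M^2 * h * (q - u^2*x^2) * (1 + A*x) * P^2
      - M^2 * (h * ((1 - u*x)^2 * (1 - u^2*x^2) * (A*x))) * q * (1 + A*q*x)"
    by algebra
  also have "\<dots> = M^2 * h * (q - u^2*x^2) * (1 + A*x) * P^2
      - M^2 * quad_coeff A u q (Suc k) * (1 - u^2*q*x^2) * P^2 * q * (1 + A*q*x)"
    unfolding hS[symmetric] by algebra
  also have "\<dots> = (H k - H (Suc k)) * (q * P^2)"
  proof -
    have "q * H k = M^2 * h * (q - u^2*x^2) * (1 + A*x)"
      using q0 by (simp add: H_def h_def x_def M_def field_simps)
    moreover have "H (Suc k) = M^2 * quad_coeff A u q (Suc k) * (1 - u^2*q*x^2) * (1 + A*q*x)"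
      using q0 by (simp add: H_def x_def M_def power2_eq_square mult_ac)
    ultimately show ?thesis
      by algebra
  qed
  finally show ?thesis
    using P0 q0 by (simp add: M_def)
qed

text \<open>Summing the WZ equation leaves the boundary value of \<open>H\<close> at k = 0. Divided
  by (1 - A u q)^2, it is the inhomogeneity (1 - u^2/q)(1 + A) of the recurrence, with A replaced by
  A q^(2n).\<close>

lemma quad_sum:
  assumes q0: "q \<noteq> 0" and q: "norm q < 1" and
    nz: "\<And>j. u^2 * q * (q^2) ^ j \<noteq> 1" "\<And>j. A * u * q * (q^2) ^ j \<noteq> 1"
  defines "S \<equiv> \<lambda>n. \<Sum>k. quad_term (A * (q^2)^n) u q k"
  shows summable_quad_term: "summable (quad_term (A * (q^2)^n) u q)"
    and quad_sum_rec: "(1 - A*(q^2)^n*u*q)^2 * (S n - (1 - u^2/q) * (1 + A*(q^2)^n))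
      = (u - A*(q^2)^n*q)^2 / q * S (Suc n)"
    and quad_sum_tendsto: "S \<longlonglongrightarrow> 1"
proof -
  note w = summable_quad_weight[OF q, of A]
  note q2 = norm_power2_less_1[OF q]
  obtain K where K: "K > 0" "\<And>n k. norm (quad_coeff (A * (q^2) ^ n) u q k)
      \<le> K * norm (q^2) ^ (n * k) * norm (quad_weight A q k)"
    using quad_coeff_bound[OF q nz] by metis
  have bnd: "norm (quad_term (A * (q^2) ^ n) u q k)
      \<le> ((1 + norm (A * u^2 / q)) * K) * norm (q^2) ^ (n * k) * norm (quad_weight A q k)" for n k
  proof -
    have "norm ((q^2) ^ n * q ^ (3*k)) \<le> 1"
      using q unfolding norm_mult norm_power by (intro mult_le_one power_le_one) auto
    then have "norm (A * u^2 / q) * norm ((q^2) ^ n * q ^ (3*k)) \<le> norm (A * u^2 / q)"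
      by (intro mult_left_le) auto
    moreover have "A * (q^2) ^ n * u^2 * q ^ (3*k) / q = (A * u^2 / q) * ((q^2) ^ n * q ^ (3*k))"
      by simp
    ultimately have "norm (A * (q^2) ^ n * u^2 * q ^ (3*k) / q) \<le> norm (A * u^2 / q)"
      by (simp only: norm_mult)
    then have "norm (1 - A * (q^2) ^ n * u^2 * q ^ (3*k) / q) \<le> 1 + norm (A * u^2 / q)"
      using norm_triangle_ineq4[of 1 "A * (q^2) ^ n * u^2 * q ^ (3*k) / q"] by simp
    from mult_mono[OF this K(2)[of n k]] show ?thesis
      unfolding quad_term_def norm_mult by (simp add: mult.assoc)
  qed
  note tends = suminf_minus_first_tendsto_0[OF norm_ge_zero q2 w bnd]
  show summ: "summable (quad_term (A * (q^2) ^ n) u q)" for n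
    by (rule tends(1))
  have "(\<lambda>n. (S n - quad_term (A * (q^2) ^ n) u q 0) + (1 - A * (q^2) ^ n * u^2 / q)) \<longlonglongrightarrow> 0 + (1 - A * 0 * u^2 / q)"
    unfolding S_def using q0 by (intro tendsto_intros tends(2) LIMSEQ_power_zero q2)
  then show "S \<longlonglongrightarrow> 1"
    by (simp add: quad_term_def quad_coeff_def quad_weight_def)
  define b where "b = A * (q^2) ^ n"
  have nzb: "b * u * q * (q^2) ^ j \<noteq> 1" for j
    using nz(2)[of "n + j"] by (simp add: b_def power_add mult_ac)
  define H where "H k = (1 - b*u*q)^2 * quad_coeff b u q k * (1 - u^2 * (q^k)^2 / q) * (1 + b * q^k)" for k
  have "summable (\<lambda>k. quad_coeff b u q k)"
  proof (rule summable_cmult_bound[OF w])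
    have "norm (q^2) ^ (n * k) \<le> 1" for k
      using q2 by (intro power_le_one) auto
    then show "norm (quad_coeff b u q k) \<le> K * norm (quad_weight A q k)" for k
      using K(2)[of n k] K(1) unfolding b_def
      by (smt (verit) mult_left_le mult_right_mono norm_ge_zero)
  qed
  then have c0: "quad_coeff b u q \<longlonglongrightarrow> 0"
    by (rule summable_LIMSEQ_zero)
  have "H \<longlonglongrightarrow> (1 - b*u*q)^2 * 0 * (1 - u^2 * 0^2 / q) * (1 + b * 0)"
    unfolding H_def using q q0 by (intro tendsto_intros c0 LIMSEQ_power_zero)
  then have "(\<lambda>k. H k - H (Suc k)) sums (H 0 - 0)"
    by (intro telescope_sums') simp
  moreover have "(\<lambda>k. H k - H (Suc k)) sums ((1 - b*u*q)^2 * S n - (u - b*q)^2 / q * S (Suc n))"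
    unfolding H_def quad_term_telescope[OF q0 nz(1) nzb, symmetric] S_def
    using summ[of n] summ[of "Suc n"]
    by (intro sums_diff sums_mult summable_sums) (auto simp: b_def mult_ac)
  ultimately have "(1 - b*u*q)^2 * S n - (u - b*q)^2 / q * S (Suc n) = (1 - b*u*q)^2 * (1 - u^2/q) * (1 + b)"
    using sums_unique2 by (fastforce simp: H_def quad_coeff_def quad_weight_def)
  then show "(1 - A*(q^2)^n*u*q)^2 * (S n - (1 - u^2/q) * (1 + A*(q^2)^n))
      = (u - A*(q^2)^n*q)^2 / q * S (Suc n)"
    unfolding b_def[symmetric] by (simp add: algebra_simps)
qed

text \<open>In base q = u^2 the inhomogeneity disappears and (u - A u^2)^2 / u^2 = (1 - A u)^2.
  Iterating A -> A u^4 builds the two squared products, and the remaining series tends to 1.\<close>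

lemma quad_sums_product:
  assumes u: "u \<noteq> 0" "norm u < 1" and nz: "\<And>j. A * u^3 * (u^4)^j \<noteq> 1"
  shows "quad_term A u (u^2) sums (q_poch_inf (A*u) (u^4) / q_poch_inf (A*u^3) (u^4)) ^ 2"
proof -
  define S where "S n = (\<Sum>k. quad_term (A * (u^4)^n) u (u^2) k)" for n
  have u2: "u^2 \<noteq> 0" "norm (u^2) < 1" and u4: "norm (u^4) < 1"
    using u norm_power2_less_1[OF u(2)] norm_power2_less_1[OF norm_power2_less_1[OF u(2)]]
    by (auto simp flip: power_mult)
  have e: "(u^2)^2 = u^4" "A * u * u^2 = A * u^3" "u^2 * u^2 = u^4"
    by (simp_all add: power2_eq_square eval_nat_numeral)
  have nz1: "u^2 * u^2 * ((u^2)^2)^j \<noteq> 1" for j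
    unfolding e using mult_power_neq_1[OF u4 u4] .
  have nz2: "A * u * u^2 * ((u^2)^2)^j \<noteq> 1" for j
    unfolding e by (rule nz)
  have "(1 - A*u^3*(u^4)^n)^2 * S n = (1 - A*u*(u^4)^n)^2 * S (Suc n)" for n
  proof -
    have e1: "(u - A*(u^4)^n*u^2)^2 / u^2 = (1 - A*u*(u^4)^n)^2"
      using u(1) by (simp add: field_simps power2_eq_square)
    have e2: "A*(u^4)^n*u*u^2 = A*u^3*(u^4)^n"
      by (simp add: eval_nat_numeral mult_ac)
    have "(1 - A*(u^4)^n*u*u^2)^2 * (S n - (1 - u^2/u^2) * (1 + A*(u^4)^n))
        = (u - A*(u^4)^n*u^2)^2 / u^2 * S (Suc n)"
      using quad_sum_rec[OF u2 nz1 nz2, of n] unfolding e S_def .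
    then show ?thesis
      unfolding e1 e2 using u(1) by simp
  qed
  then have step: "S n * (1 - A*u^3*(u^4)^n)^2 = (1 - A*u*(u^4)^n)^2 * S (Suc n)" for n
    by (simp add: mult.commute)
  have iter: "q_poch (A*u^3) (u^4) n ^ 2 * S 0 = q_poch (A*u) (u^4) n ^ 2 * S n" for n
  proof (induction n)
    case (Suc n)
    have "q_poch (A*u^3) (u^4) (Suc n) ^ 2 * S 0 = (q_poch (A*u^3) (u^4) n ^ 2 * S 0) * (1 - A*u^3*(u^4)^n)^2"
      by (simp add: q_poch_Suc power_mult_distrib mult_ac)
    also have "\<dots> = q_poch (A*u) (u^4) n ^ 2 * (S n * (1 - A*u^3*(u^4)^n)^2)"
      unfolding Suc.IH by (simp only: mult_ac)
    also have "\<dots> = q_poch (A*u) (u^4) (Suc n) ^ 2 * S (Suc n)"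
      unfolding step by (simp add: q_poch_Suc power_mult_distrib mult_ac)
    finally show ?case .
  qed simp
  have S1: "S \<longlonglongrightarrow> 1"
    using quad_sum_tendsto[OF u2 nz1 nz2] unfolding S_def e .
  have "(\<lambda>n. q_poch (A*u^3) (u^4) n ^ 2 * S 0) \<longlonglongrightarrow> q_poch_inf (A*u^3) (u^4) ^ 2 * S 0"
    by (intro tendsto_intros q_poch_tendsto u4)
  moreover have "(\<lambda>n. q_poch (A*u^3) (u^4) n ^ 2 * S 0) \<longlonglongrightarrow> q_poch_inf (A*u) (u^4) ^ 2 * 1"
    unfolding iter by (intro tendsto_mult tendsto_power q_poch_tendsto u4 S1)
  ultimately have "q_poch_inf (A*u^3) (u^4) ^ 2 * S 0 = q_poch_inf (A*u) (u^4) ^ 2"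
    using LIMSEQ_unique by fastforce
  moreover have "q_poch_inf (A*u^3) (u^4) \<noteq> 0"
    by (rule q_poch_inf_nonzero[OF u4 nz])
  ultimately have "S 0 = (q_poch_inf (A*u) (u^4) / q_poch_inf (A*u^3) (u^4)) ^ 2"
    by (simp add: field_simps)
  then show ?thesis
    using summable_sums[OF summable_quad_term[OF u2 nz1 nz2, of 0]] by (simp add: S_def)
qed

text \<open>For u = q the multiplier of the recurrence is q times a quotient of consecutive squares
  (1 - A q^(2n))^2, so a suitable normalisation makes the inhomogeneities telescope to the series
  itself.\<close>

lemma quad_sums_lambert:
  assumes q: "q \<noteq> 0" "norm q < 1" and nz: "\<And>j. A * (q^2)^j \<noteq> 1"
  shows "summable (quad_term A q q)"
    and "(\<lambda>n. (1 - q) * (1 + A * (q^2)^n) * q^n / (1 - A * (q^2)^n)^2)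
      sums ((\<Sum>k. quad_term A q q k) / (1 - A)^2)"
proof -
  define S where "S n = (\<Sum>k. quad_term (A * (q^2)^n) q q k)" for n
  have nz1: "q^2 * q * (q^2)^j \<noteq> 1" for j
  proof -
    have "norm (q^3) < 1"
      using q(2) by (simp add: norm_power power_less_one_iff)
    then show ?thesis
      using mult_power_neq_1[OF _ norm_power2_less_1[OF q(2)], of "q^3"] by (simp add: eval_nat_numeral mult.assoc)
  qed
  have nz2: "A * q * q * (q^2)^j \<noteq> 1" for j
    using nz[of "Suc j"] by (simp add: power2_eq_square mult_ac)
  show "summable (quad_term A q q)"
    using summable_quad_term[OF q nz1 nz2, of 0] by simp
  have S1: "S \<longlonglongrightarrow> 1"
    unfolding S_def by (rule quad_sum_tendsto[OF q nz1 nz2])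
  \<comment> \<open>The summation factor q^n / (1 - A q^(2n))^2 turns the recurrence into a plain
    difference. \<open>T\<close> tends to 0 because q^n does and \<open>S\<close> tends to
    1.\<close>
  define T where "T n = S n * q^n / (1 - A * (q^2)^n)^2" for n
  have "T \<longlonglongrightarrow> 1 * 0 / (1 - A * 0)^2"
    unfolding T_def using q(2) norm_power2_less_1[OF q(2)] by (intro tendsto_intros S1 LIMSEQ_power_zero) auto
  then have "(\<lambda>n. T n - T (Suc n)) sums (T 0 - 0)"
    by (intro telescope_sums') simp
  moreover have "T n - T (Suc n) = (1 - q) * (1 + A * (q^2)^n) * q^n / (1 - A * (q^2)^n)^2" for n
  proof -
    define b where "b = A * (q^2)^n"
    have b: "1 - b \<noteq> 0" "1 - b * q^2 \<noteq> 0"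
      using nz[of n] nz[of "Suc n"] by (simp_all add: b_def mult_ac)
    have e: "(q - b*q)^2 / q = q * (1 - b)^2" "q^2/q = q" "b * q * q = b * q^2"
      using q(1) by (simp_all add: field_simps power2_eq_square)
    have "(1 - b*q*q)^2 * (S n - (1 - q^2/q) * (1 + b)) = (q - b*q)^2 / q * S (Suc n)"
      using quad_sum_rec[OF q nz1 nz2, of n] unfolding S_def b_def[symmetric] .
    then have "(1 - b*q^2)^2 * (S n - (1 - q) * (1 + b)) = q * (1 - b)^2 * S (Suc n)"
      unfolding e .
    then have "S (Suc n) * q / (1 - b*q^2)^2 = (S n - (1 - q) * (1 + b)) / (1 - b)^2"
      using b by (simp add: divide_eq_eq eq_divide_eq mult_ac)
    moreover have "T (Suc n) = q^n * (S (Suc n) * q / (1 - b*q^2)^2)"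
      unfolding T_def b_def by (simp add: mult_ac)
    ultimately have "T n - T (Suc n) = q^n * S n / (1 - b)^2 - q^n * ((S n - (1 - q) * (1 + b)) / (1 - b)^2)"
      unfolding T_def b_def[symmetric] by (simp add: mult.commute)
    also have "\<dots> = (1 - q) * (1 + b) * q^n / (1 - b)^2"
      by (simp add: algebra_simps flip: diff_divide_distrib add_divide_distrib)
    finally show ?thesis
      by (simp add: b_def)
  qed
  ultimately show "(\<lambda>n. (1 - q) * (1 + A * (q^2)^n) * q^n / (1 - A * (q^2)^n)^2)
      sums ((\<Sum>k. quad_term A q q k) / (1 - A)^2)"
    by (simp add: T_def S_def)
qed

section \<open>Specialised weights in base q^2 and the Lambert series of the fourth power of
  psi\<close>

lemma q_poch_zero [simp]: "q_poch 0 q k = 1"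
  by (simp add: q_poch_def)

lemma q_poch_inf_zero [simp]: "q_poch_inf 0 q = 1"
  by (simp add: q_poch_inf_def)

lemma q_number_minus_1:
  assumes "q \<noteq> 0" "q \<noteq> 1"
  shows "q_number n q - 1 = q * (1 - q ^ n / q) / (1 - q)"
  using assms by (simp add: q_number_def field_simps)

lemma q_poch_square_base: "q_poch (q^2) (q^2) k = q_poch q q k * q_poch (-q) q k"
proof (induction k)
  case (Suc k)
  have "1 - q^2 * (q^2)^k = (1 - q * q^k) * (1 - - q * q^k)"
    by (simp add: algebra_simps power2_eq_square power_mult_distrib)
  with Suc show ?case
    by (simp add: q_poch_Suc mult_ac)
qed simp

text \<open>With E = 0 the factor E - q^(2j) gives the sign and the quadratic exponent; the two
  factors 1/q - q^(2j) give the squared factorial.\<close>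

lemma vwp_weight_cube:
  assumes "q \<noteq> 0"
  shows "vwp_weight (q^3) (1/q) (1/q) 0 (q^2) k
    = (-1) ^ k * q ^ (k^2 + 2*k) * q_poch q (q^2) k ^ 2 / q_poch (q^2) (q^2) k"
proof (induction k)
  case (Suc k)
  define x where "x = (q^2) ^ k"
  have e1: "(1/q - x)^2 * (0 - x) * (q^3 * q^2) = - ((1 - q * x)^2 * (q^3 * x))"
    using assms by (simp add: field_simps power2_eq_square power3_eq_cube)
  have e2: "q ^ ((Suc k)^2 + 2 * Suc k) = q ^ (k^2 + 2*k) * (q^3 * x)"
  proof -
    have "(Suc k)^2 + 2 * Suc k = (k^2 + 2*k) + (3 + 2*k)"
      by (simp add: power2_eq_square)
    then show ?thesis
      by (simp only: power_add power_mult x_def)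
  qed
  have e3: "vwp_weight (q^3) (1/q) (1/q) 0 (q^2) (Suc k)
      = vwp_weight (q^3) (1/q) (1/q) 0 (q^2) k * ((1/q - x)^2 * (0 - x) * (q^3 * q^2)) / (1 - q^2 * x)"
    by (simp add: vwp_weight_def x_def power2_eq_square)
  show ?case
    unfolding e3 e1 e2 Suc.IH by (simp add: q_poch_Suc power_mult_distrib mult_ac flip: x_def)
qed (simp add: vwp_weight_def)

lemma vwp_weight_inverse:
  assumes "q \<noteq> 0"
  shows "vwp_weight (1/q) q q 0 (q^2) k
    = (-1) ^ k * q ^ (k^2 + 2*k) * q_poch (1/q) (q^2) k ^ 2 / q_poch (q^2) (q^2) k"
proof (induction k)
  case (Suc k)
  define x where "x = (q^2) ^ k"
  have e1: "(q - x)^2 * (0 - x) * (1/q * q^2) = - ((1 - 1/q * x)^2 * (q^3 * x))"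
    using assms by (simp add: field_simps power2_eq_square power3_eq_cube)
  have e2: "q ^ ((Suc k)^2 + 2 * Suc k) = q ^ (k^2 + 2*k) * (q^3 * x)"
  proof -
    have "(Suc k)^2 + 2 * Suc k = (k^2 + 2*k) + (3 + 2*k)"
      by (simp add: power2_eq_square)
    then show ?thesis
      by (simp only: power_add power_mult x_def)
  qed
  have e3: "vwp_weight (1/q) q q 0 (q^2) (Suc k)
      = vwp_weight (1/q) q q 0 (q^2) k * ((q - x)^2 * (0 - x) * (1/q * q^2)) / (1 - q^2 * x)"
    by (simp add: vwp_weight_def x_def power2_eq_square)
  show ?case
    unfolding e3 e1 e2 Suc.IH by (simp add: q_poch_Suc power_mult_distrib mult_ac flip: x_def)
qed (simp add: vwp_weight_def)

lemma vwp_weight_square: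
  assumes "q \<noteq> 0"
  shows "vwp_weight (q^2) (1/q) (1/q) (1/q) (q^2) k
    = q ^ k * q_poch q (q^2) k ^ 3 / q_poch (q^2) (q^2) k"
proof (induction k)
  case (Suc k)
  define x where "x = (q^2) ^ k"
  have e1: "(1/q - x)^3 * (q^2 * q^2) = (1 - q * x)^3 * q"
    using assms by (simp add: field_simps power2_eq_square power3_eq_cube)
  have e3: "vwp_weight (q^2) (1/q) (1/q) (1/q) (q^2) (Suc k)
      = vwp_weight (q^2) (1/q) (1/q) (1/q) (q^2) k * ((1/q - x)^3 * (q^2 * q^2)) / (1 - q^2 * x)"
    by (simp add: vwp_weight_def x_def power2_eq_square power3_eq_cube)
  show ?case
    unfolding e3 e1 Suc.IH by (simp add: q_poch_Suc power_mult_distrib mult_ac flip: x_def)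
qed (simp add: vwp_weight_def)

text \<open>The case a = q^2, b = c = d = q of the 6phi5 sum in base q^2. The quotients (q;q^2)_n /
  (q^3;q^2)_n collapse to (1 - q)/(1 - q^(2n+1)), so each term is q^n times a rational function of y
  = q^(2n+1). Expanding (1 + y)/(1 - y)^2 yields the four triangular numbers theorem.\<close>

lemma psi_fourth_power_sums:
  fixes q :: complex
  assumes "q \<noteq> 0" "norm q < 1"
  shows "(\<lambda>n. (1 + q * (q^2)^n) * q^n / (1 - q * (q^2)^n)^2)
    sums (q_poch_inf (q^2) (q^2) ^ 4 / q_poch_inf q (q^2) ^ 4)"
proof -
  note q2 = norm_power2_less_1[OF assms(2)]
  have nz1: "q * (q^2)^j \<noteq> 1" for j
    by (rule mult_power_neq_1[OF assms(2) q2])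
  have nz3: "q^3 * (q^2)^j \<noteq> 1" for j
    using mult_power_neq_1_shift[of q "q^2" 1, OF nz1] by (simp add: eval_nat_numeral mult_ac)
  have nz2: "q^2 * (q^2)^j \<noteq> 1" for j
    by (rule mult_power_neq_1[OF q2 q2])
  have e: "q^2 * q^2 * (1/q) = q^3" "q^3 * (1/q) = q^2" "q^2 * (1/q) = q"
    using assms(1) by (simp_all add: eval_nat_numeral)
  have q1: "1 - q \<noteq> 0"
    using nz1[of 0] by simp
  have inf: "q_poch_inf q (q^2) = (1 - q) * q_poch_inf (q^3) (q^2)"
    using q_poch_inf_rec[OF q2, of q] by (simp add: eval_nat_numeral)
  have "vwp_term (q^2) (1/q) (1/q) (1/q) (q^2) sums
      (q_poch_inf (q^2) (q^2) * q_poch_inf (q^2) (q^2) * q_poch_inf (q^2) (q^2) * q_poch_inf (q^2) (q^2) /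
      (q_poch_inf (q^3) (q^2) * q_poch_inf (q^3) (q^2) * q_poch_inf (q^3) (q^2) * q_poch_inf q (q^2)))"
    using vwp_sums[of "q^2" "q^2" "1/q" "1/q" "1/q"] nz3 assms(2) q2 unfolding e by blast
  then have "(\<lambda>n. vwp_term (q^2) (1/q) (1/q) (1/q) (q^2) n / (1 - q)^3) sums
      (q_poch_inf (q^2) (q^2) ^ 4 / (q_poch_inf (q^3) (q^2) ^ 3 * q_poch_inf q (q^2)) / (1 - q)^3)"
    by (intro sums_divide) (simp add: eval_nat_numeral mult_ac)
  moreover have "q_poch_inf (q^2) (q^2) ^ 4 / (q_poch_inf (q^3) (q^2) ^ 3 * q_poch_inf q (q^2)) / (1 - q)^3
      = q_poch_inf (q^2) (q^2) ^ 4 / q_poch_inf q (q^2) ^ 4"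
    unfolding inf using q1 by (simp add: eval_nat_numeral mult_ac)
  moreover have "vwp_term (q^2) (1/q) (1/q) (1/q) (q^2) n / (1 - q)^3
      = (1 + q * (q^2)^n) * q^n / (1 - q * (q^2)^n)^2" for n
  proof -
    define y where "y = q * (q^2)^n"
    have y: "1 - y \<noteq> 0"
      using nz1[of n] by (simp add: y_def)
    have p: "q_poch (q^3) (q^2) n \<noteq> 0" "q_poch (q^2) (q^2) n \<noteq> 0"
      using nz3 nz2 by (auto simp: q_poch_eq_0_iff)
    have "(1 - q) * q_poch (q^3) (q^2) n = q_poch q (q^2) n * (1 - y)"
      using q_poch_shift[of q "q^2" n] by (simp add: y_def eval_nat_numeral)
    then have r: "q_poch q (q^2) n = (1 - q) / (1 - y) * q_poch (q^3) (q^2) n"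
      using y by (simp add: field_simps)
    have "vwp_coeff (q^2) (1/q) (1/q) (1/q) (q^2) n = q^n * ((1 - q) / (1 - y))^3"
      unfolding vwp_coeff_def e vwp_weight_square[OF assms(1)] r power_mult_distrib
      using p by (simp add: power3_eq_cube mult_ac)
    moreover have "1 - q^2 * (q^2)^(2*n) = (1 + y) * (1 - y)"
      unfolding y_def power_even_eq by algebra
    ultimately have "vwp_term (q^2) (1/q) (1/q) (1/q) (q^2) n
        = (1 + y) * (1 - y) * (q^n * ((1 - q) / (1 - y))^3)"
      by (simp add: vwp_term_def)
    then show ?thesis
      unfolding y_def[symmetric] using y q1 by (simp add: power2_eq_square power3_eq_cube mult_ac)
  qed
  ultimately show ?thesis
    by (simp only:)
qed

section \<open>Derivation of the four identities from the two families\<close>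

theorem theorem1p2:
  fixes q :: complex
  assumes "0 < norm q" and "norm q < 1"
  shows
    "((\<lambda>k. (-1) ^ k * q ^ (k^2)
          * (q_number (2*k) q * (q_number (4*k) q - 1) / (q_number (2*k) q - 1) ^ 2)
          * (q_poch q (q^2) k ^ 3 / q_poch (q^2) (q^2) k ^ 3))
       sums (- (q_poch_inf q (q^2) * q_poch_inf (q^3) (q^2) / q_poch_inf (q^2) (q^2) ^ 2)))
     \<and>
     ((\<lambda>k. (-1) ^ k * q ^ (k^2 + 2*k)
          * ((q_number (4*k) q - 1) / (q_number (2*k) q - 1) ^ 3)
          * (q_poch q (q^2) k ^ 3 / q_poch (q^2) (q^2) k ^ 3))
       sums (q_poch_inf q (q^2) * q_poch_inf (q^3) (q^2) / q_poch_inf (q^2) (q^2) ^ 2))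
     \<and>
     ((\<lambda>k. P_poly k q * q ^ (k^2) / ((1 - q) ^ 3 * (q_number (2*k) q - 1) ^ 2)
          * (q_poch q (q^2) k ^ 2 * q_poch (q^2) (q^4) k / q_poch (q^4) (q^4) k ^ 3))
       sums (2 * q * (1 + q)
          * (q_poch_inf (q^2) (q^4) * q_poch_inf (q^6) (q^4) / q_poch_inf (q^4) (q^4) ^ 2)))
     \<and>
     (summable (\<lambda>k. q_number (3*k + 4) q / q_number (2*k + 3) q ^ 2
          * (q_poch q q k ^ 3 * q_poch (-q) q k / q_poch (q^3) (q^2) k ^ 3)
          * q ^ (k * (k + 5) div 2)))
     \<and>
     (q * (\<Sum>k. q_number (3*k + 4) q / q_number (2*k + 3) q ^ 2
          * (q_poch q q k ^ 3 * q_poch (-q) q k / q_poch (q^3) (q^2) k ^ 3)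
          * q ^ (k * (k + 5) div 2))
     = (1 - q) ^ 2 * (q_poch_inf (q^2) (q^2) ^ 4 / q_poch_inf q (q^2) ^ 4) - 1 - q)"
proof -
  have q0: "q \<noteq> 0" and q: "norm q < 1"
    using assms by auto
  note q2 = norm_power2_less_1[OF q]
  have q4: "norm (q^4) < 1"
    using norm_power2_less_1[OF q2] by (simp flip: power_mult)
  have nz1: "q * (q^2)^j \<noteq> 1" for j
    by (rule mult_power_neq_1[OF q q2])
  have nz3: "q^3 * (q^2)^j \<noteq> 1" for j
    using mult_power_neq_1_shift[of q "q^2" 1, OF nz1] by (simp add: eval_nat_numeral mult_ac)
  have nz2: "q^2 * (q^2)^j \<noteq> 1" for j
    by (rule mult_power_neq_1[OF q2 q2])
  have nz4: "q^4 * (q^2)^j \<noteq> 1" for j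
    by (rule mult_power_neq_1[OF q4 q2])
  have nz44: "q^4 * (q^4)^j \<noteq> 1" for j
    by (rule mult_power_neq_1[OF q4 q4])
  have q1: "1 - q \<noteq> 0" "q \<noteq> 1"
    using nz1[of 0] by auto
  \<comment> \<open>This keeps \<open>q_number (2*k) q - 1\<close> away from 0. The case k = 0 is
    separate because the exponent 2k - 1 is then negative.\<close>
  have nzi: "1 - (q^2)^k / q \<noteq> 0" for k
  proof (cases k)
    case (Suc j)
    then have "(q^2)^k / q = q * (q^2)^j"
      using q0 by (simp add: power2_eq_square)
    then show ?thesis
      using nz1[of j] by simp
  qed (use q0 q1 in simp)
  have inf1: "q_poch_inf q (q^2) = (1 - q) * q_poch_inf (q^3) (q^2)"
    using q_poch_inf_rec[OF q2, of q] by (simp add: eval_nat_numeral)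
  have inf2: "q_poch_inf (q^2) (q^2) = (1 - q^2) * q_poch_inf (q^4) (q^2)"
    using q_poch_inf_rec[OF q2, of "q^2"] by (simp add: eval_nat_numeral mult.assoc)
  have num2: "q_number (2*k) q - 1 = q * (1 - (q^2)^k / q) / (1 - q)" for k
    using q_number_minus_1[OF q0 q1(2), of "2*k"] by (simp add: power_mult)
  have num4: "q_number (4*k) q - 1 = q * (1 - ((q^2)^k)^2 / q) / (1 - q)" for k
    using q_number_minus_1[OF q0 q1(2), of "4*k"] by (simp add: mult.commute flip: power_mult)

  let ?f1 = "\<lambda>k. (-1) ^ k * q ^ (k^2)
          * (q_number (2*k) q * (q_number (4*k) q - 1) / (q_number (2*k) q - 1) ^ 2)
          * (q_poch q (q^2) k ^ 3 / q_poch (q^2) (q^2) k ^ 3)"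
  have id1: "?f1 sums (- (q_poch_inf q (q^2) * q_poch_inf (q^3) (q^2) / q_poch_inf (q^2) (q^2) ^ 2))"
  \<comment> \<open>The term k = 0 vanishes since [0]_q = 0; after the shift by one, the series is
    the 6phi5 with a = q^3, b = c = q, d infinite.\<close>
  proof (rule sums_Suc_imp)
    show "?f1 0 = 0"
      by (simp add: q_number_def)
    have e: "q^3 * q^2 * (1/q) = q^4" "q^4 * (1/q) = q^3" "q^3 * q^2 * 0 = 0" "q^4 * 0 = 0" "q^3 * 0 = 0"
      using q0 by (simp_all add: eval_nat_numeral)
    have "vwp_term (q^3) (1/q) (1/q) 0 (q^2) sums
      (q_poch_inf (q^3) (q^2) * q_poch_inf (q^3) (q^2) * q_poch_inf 0 (q^2) * q_poch_inf 0 (q^2) /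
      (q_poch_inf (q^4) (q^2) * q_poch_inf (q^4) (q^2) * q_poch_inf 0 (q^2) * q_poch_inf 0 (q^2)))"
      using vwp_sums[of "q^2" "q^3" "1/q" "1/q" 0] nz4 q2 unfolding e by simp
    \<comment> \<open>The constant is the term k = 1 of the wanted series divided by the initial
      6phi5 term 1 - q^3.\<close>
    then have "(\<lambda>k. (- ((1 - q) / (1 - q^2)^2)) * vwp_term (q^3) (1/q) (1/q) 0 (q^2) k) sums
        ((- ((1 - q) / (1 - q^2)^2)) * (q_poch_inf (q^3) (q^2) ^ 2 / q_poch_inf (q^4) (q^2) ^ 2))"
      by (intro sums_mult) (simp add: power2_eq_square)
    moreover have "(- ((1 - q) / (1 - q^2)^2)) * (q_poch_inf (q^3) (q^2) ^ 2 / q_poch_inf (q^4) (q^2) ^ 2)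
        = - (q_poch_inf q (q^2) * q_poch_inf (q^3) (q^2) / q_poch_inf (q^2) (q^2) ^ 2)"
      unfolding inf1 inf2 by (simp add: power2_eq_square mult_ac)
    moreover have "(- ((1 - q) / (1 - q^2)^2)) * vwp_term (q^3) (1/q) (1/q) 0 (q^2) k = ?f1 (Suc k)" for k
    proof -
      define x where "x = (q^2)^k"
      have y: "1 - q*x \<noteq> 0" "1 - q^2*x \<noteq> 0" "1 - q^2 \<noteq> 0"
        using nz1[of k] nz2[of k] nz2[of 0] by (simp_all add: x_def)
      have c1: "q_poch (q^3) (q^2) k = q_poch q (q^2) k * (1 - q*x) / (1 - q)"
        using q_poch_shift[of q "q^2" k] q1 by (simp add: x_def eval_nat_numeral field_simps)
      have c2: "q_poch (q^4) (q^2) k = q_poch (q^2) (q^2) k * (1 - q^2*x) / (1 - q^2)"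
        using q_poch_shift[of "q^2" "q^2" k] y by (simp add: x_def eval_nat_numeral field_simps)
      have xx: "(q^2)^(2*k) = x^2"
        by (simp add: x_def mult.commute flip: power_mult)
      have "vwp_term (q^3) (1/q) (1/q) 0 (q^2) k = (1 - q^3*x^2) * ((-1) ^ k * q ^ (k^2 + 2*k)
          * q_poch q (q^2) k ^ 2 / q_poch (q^2) (q^2) k * q_poch (q^3) (q^2) k / q_poch (q^4) (q^2) k ^ 2)"
        unfolding vwp_term_def vwp_coeff_def e vwp_weight_cube[OF q0] xx
        by (simp add: power2_eq_square mult_ac)
      also have "\<dots> = (-1) ^ k * q ^ (k^2 + 2*k) * (1 - q^3*x^2) * (1 - q*x) * (1 - q^2)^2
          / ((1 - q) * (1 - q^2*x)^2) * (q_poch q (q^2) k ^ 3 / q_poch (q^2) (q^2) k ^ 3)"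
        unfolding c1 c2 by (simp add: power2_eq_square power3_eq_cube mult_ac)
      finally have lhs: "(- ((1 - q) / (1 - q^2)^2)) * vwp_term (q^3) (1/q) (1/q) 0 (q^2) k
        = - ((-1) ^ k * q ^ (k^2 + 2*k) * (1 - q^3*x^2) * (1 - q*x) / (1 - q^2*x)^2
          * (q_poch q (q^2) k ^ 3 / q_poch (q^2) (q^2) k ^ 3))"
        using q1 y by simp
      have s: "(q^2)^Suc k = q^2 * x"
        by (simp add: x_def)
      have n2: "q_number (2 * Suc k) q = (1 - q^2*x) / (1 - q)"
        unfolding q_number_def power_mult s ..
      have n2': "q_number (2 * Suc k) q - 1 = q * (1 - q*x) / (1 - q)"
        unfolding num2 s using q0 by (simp add: power2_eq_square)
      have n4: "q_number (4 * Suc k) q - 1 = q * (1 - q^3*x^2) / (1 - q)"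
        unfolding num4 s using q0 by (simp add: power2_eq_square power3_eq_cube mult_ac)
      have "q_number (2 * Suc k) q * (q_number (4 * Suc k) q - 1) / (q_number (2 * Suc k) q - 1) ^ 2
          = (1 - q^2*x) * (1 - q^3*x^2) / (q * (1 - q*x)^2)"
        unfolding n2' n4 unfolding n2 using q0 q1 y by (simp add: power2_eq_square)
      moreover have "q ^ ((Suc k)^2) = q ^ (k^2 + 2*k) * q"
        by (simp add: power2_eq_square mult_2 add_ac flip: power_Suc2)
      moreover have "q_poch q (q^2) (Suc k) = q_poch q (q^2) k * (1 - q*x)"
        and "q_poch (q^2) (q^2) (Suc k) = q_poch (q^2) (q^2) k * (1 - q^2*x)"
        by (simp_all add: q_poch_Suc x_def)
      ultimately have "?f1 (Suc k) = (-1) ^ Suc k * (q ^ (k^2 + 2*k) * q)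
          * ((1 - q^2*x) * (1 - q^3*x^2) / (q * (1 - q*x)^2))
          * ((q_poch q (q^2) k * (1 - q*x)) ^ 3 / (q_poch (q^2) (q^2) k * (1 - q^2*x)) ^ 3)"
        by (simp only:)
      then show ?thesis
        unfolding lhs using q0 y by (simp add: power2_eq_square power3_eq_cube mult_ac)
    qed
    ultimately show "(\<lambda>k. ?f1 (Suc k)) sums
        (- (q_poch_inf q (q^2) * q_poch_inf (q^3) (q^2) / q_poch_inf (q^2) (q^2) ^ 2))"
      by simp
  qed

  let ?f2 = "\<lambda>k. (-1) ^ k * q ^ (k^2 + 2*k)
          * ((q_number (4*k) q - 1) / (q_number (2*k) q - 1) ^ 3)
          * (q_poch q (q^2) k ^ 3 / q_poch (q^2) (q^2) k ^ 3)"
  have id2: "?f2 sums (q_poch_inf q (q^2) * q_poch_inf (q^3) (q^2) / q_poch_inf (q^2) (q^2) ^ 2)"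
  proof -
    have e: "1/q * q^2 * q = q^2" "q^2 * q = q^3" "1/q * q^2 * 0 = 0" "q^2 * 0 = 0" "q^3 * 0 = 0" "1/q * q^2 = q"
      using q0 by (simp_all add: eval_nat_numeral)
    have i: "1 - 1/q \<noteq> 0"
      using q0 q1 by simp
    have "q_poch_inf (1/q) (q^2) = (1 - 1/q) * q_poch_inf q (q^2)"
      using q_poch_inf_rec[OF q2, of "1/q"] unfolding e .
    moreover have "vwp_term (1/q) q q 0 (q^2) sums
      (q_poch_inf (1/q) (q^2) * q_poch_inf (q^3) (q^2) * q_poch_inf 0 (q^2) * q_poch_inf 0 (q^2) /
      (q_poch_inf (q^2) (q^2) * q_poch_inf (q^2) (q^2) * q_poch_inf 0 (q^2) * q_poch_inf 0 (q^2)))"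
      using vwp_sums[of "q^2" "1/q" q q 0] nz2 q2 unfolding e(1-5) by simp
    ultimately have "(\<lambda>k. vwp_term (1/q) q q 0 (q^2) k / (1 - 1/q)) sums
        ((1 - 1/q) * (q_poch_inf q (q^2) * q_poch_inf (q^3) (q^2) / q_poch_inf (q^2) (q^2) ^ 2) / (1 - 1/q))"
      by (intro sums_divide) (simp add: power2_eq_square mult_ac)
    moreover have "vwp_term (1/q) q q 0 (q^2) k / (1 - 1/q) = ?f2 k" for k
    proof -
      define x where "x = (q^2)^k"
      have y: "1 - x/q \<noteq> 0"
        using nzi[of k] by (simp add: x_def)
      have xx: "(q^2)^(2*k) = x^2"
        by (simp add: x_def mult.commute flip: power_mult)
      \<comment> \<open>Here a = b = c = 1/q. The cube of (1/q;q^2)_k, rewritten through (q;q^2)_k,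
        produces the denominator ([2k]_q - 1)^3; the extra factor 1 - 1/q matches the one split off
        the infinite product.\<close>
      have "(1 - 1/q) * q_poch q (q^2) k = q_poch (1/q) (q^2) k * (1 - x/q)"
        using q_poch_shift[of "1/q" "q^2" k] unfolding e by (simp add: x_def)
      then have c: "q_poch (1/q) (q^2) k = (1 - 1/q) / (1 - x/q) * q_poch q (q^2) k"
        using y by (simp add: eq_divide_eq)
      have "vwp_term (1/q) q q 0 (q^2) k = (1 - x^2/q) * ((-1) ^ k * q ^ (k^2 + 2*k)
          * (q_poch (1/q) (q^2) k ^ 3 / q_poch (q^2) (q^2) k ^ 3))"
        unfolding vwp_term_def vwp_coeff_def e vwp_weight_inverse[OF q0] xx
        by (simp add: power2_eq_square power3_eq_cube mult_ac)
      also have "\<dots> / (1 - 1/q) = (-1) ^ k * q ^ (k^2 + 2*k) * ((1 - x^2/q) * (1 - 1/q)^2 / (1 - x/q)^3)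
          * (q_poch q (q^2) k ^ 3 / q_poch (q^2) (q^2) k ^ 3)"
        unfolding c power_mult_distrib power_divide using i by (simp add: power2_eq_square power3_eq_cube mult_ac)
      also have "(1 - x^2/q) * (1 - 1/q)^2 / (1 - x/q)^3
          = (q_number (4*k) q - 1) / (q_number (2*k) q - 1) ^ 3"
      proof -
        have "1 - 1/q = - ((1 - q) / q)"
          using q0 by (simp add: field_simps)
        then show ?thesis
          unfolding num2 num4 x_def[symmetric] using q0 q1 y
          by (simp add: power2_eq_square power3_eq_cube mult_ac)
      qed
      finally show ?thesis .
    qed
    ultimately show ?thesis
      by (simp only: nonzero_mult_div_cancel_left[OF i])
  qed

  let ?f3 = "\<lambda>k. P_poly k q * q ^ (k^2) / ((1 - q) ^ 3 * (q_number (2*k) q - 1) ^ 2)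
          * (q_poch q (q^2) k ^ 2 * q_poch (q^2) (q^4) k / q_poch (q^4) (q^4) k ^ 3)"
  have id3: "?f3 sums (2 * q * (1 + q)
          * (q_poch_inf (q^2) (q^4) * q_poch_inf (q^6) (q^4) / q_poch_inf (q^4) (q^4) ^ 2))"
  proof -
    have e: "(q^2)^2 = q^4" "q^2 * q^2 = q^4" "q * q * q^2 = q^4" "q * q^3 = q^4" "q * q = q^2"
      by (simp_all add: eval_nat_numeral)
    define h where "h = quad_coeff q q (q^2)"
    \<comment> \<open>The wanted series is 2 q times the product-case series with A = u = q, plus
      the difference of \<open>D\<close>, all over 1 - q. \<open>D\<close> is zero at k = 0 and
      tends to 0, so it contributes nothing.\<close>
    define D where "D k = h k * (1 - ((q^2)^k)^2)^3 / (q * (1 - (q^2)^k/q)^2)" for k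
    have sq: "q ^ ((Suc k)^2) = q ^ (k^2) * (q * (q^2)^k)" for k
    proof -
      have "(Suc k)^2 = k^2 + (1 + 2*k)"
        by (simp add: power2_eq_square)
      then show ?thesis
        by (simp only: power_add power_mult power_one_right)
    qed
    have w: "quad_weight q (q^2) k = q ^ (k^2)" for k
    proof (induction k)
      case (Suc k)
      then show ?case
        unfolding sq by (simp add: quad_weight_def)
    qed (simp add: quad_weight_def)
    have h: "h k = q ^ (k^2) * (q_poch q (q^2) k ^ 2 * q_poch (q^2) (q^4) k / q_poch (q^4) (q^4) k ^ 3)" for k
      unfolding h_def quad_coeff_def w e by (simp add: power2_eq_square power3_eq_cube mult_ac)
    have t: "quad_term q q (q^2) k = (1 - q * ((q^2)^k)^3) * h k" for k
      using q0 by (simp add: quad_term_def h_def mult.commute flip: power_mult)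
    have sm: "quad_term q q (q^2) sums (q_poch_inf (q^2) (q^4) / q_poch_inf (q^4) (q^4)) ^ 2"
      using quad_sums_product[OF q0 q, of q] nz44 unfolding e by simp
    \<comment> \<open>Decay of the bare coefficient is recovered from the summable terms by dividing
      out a factor that is never zero and tends to 1.\<close>
    have "(\<lambda>k. quad_term q q (q^2) k / (1 - q * ((q^2)^k)^3)) \<longlonglongrightarrow> 0 / (1 - q * 0^3)"
      by (intro tendsto_intros summable_LIMSEQ_zero[OF sums_summable[OF sm]] LIMSEQ_power_zero q2) simp
    moreover have "quad_term q q (q^2) k / (1 - q * ((q^2)^k)^3) = h k" for k
    proof -
      have "q * ((q^2)^k)^3 \<noteq> 1"
        using mult_power_neq_1[OF q q, of "6*k"] by (simp add: mult.commute flip: power_mult)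
      then show ?thesis
        by (simp add: t)
    qed
    ultimately have h0: "h \<longlonglongrightarrow> 0"
      by (simp add: fun_eq_iff[symmetric])
    have "D \<longlonglongrightarrow> 0 * (1 - 0^2)^3 / (q * (1 - 0/q)^2)"
      unfolding D_def using q0 by (intro tendsto_intros h0 LIMSEQ_power_zero q2) simp_all
    then have "(\<lambda>k. D (Suc k) - D k) sums (0 - D 0)"
      by (intro telescope_sums) simp
    moreover have "D 0 = 0"
      by (simp add: D_def)
    ultimately have "(\<lambda>k. (2 * q * quad_term q q (q^2) k + (D (Suc k) - D k)) / (1 - q)) sums
        ((2 * q * (q_poch_inf (q^2) (q^4) / q_poch_inf (q^4) (q^4)) ^ 2 + 0) / (1 - q))"
      by (intro sums_divide sums_add sums_mult sm) simp
    moreover have "(2 * q * (q_poch_inf (q^2) (q^4) / q_poch_inf (q^4) (q^4)) ^ 2 + 0) / (1 - q)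
        = 2 * q * (1 + q) * (q_poch_inf (q^2) (q^4) * q_poch_inf (q^6) (q^4) / q_poch_inf (q^4) (q^4) ^ 2)"
    proof -
      have "q_poch_inf (q^2) (q^4) = (1 - q^2) * q_poch_inf (q^6) (q^4)"
        using q_poch_inf_rec[OF q4, of "q^2"] by (simp flip: power_add)
      moreover have "1 - q^2 = (1 - q) * (1 + q)"
        by (simp add: algebra_simps power2_eq_square)
      ultimately show ?thesis
        using q1 by (simp add: power2_eq_square power_divide mult_ac)
    qed
    moreover have "(2 * q * quad_term q q (q^2) k + (D (Suc k) - D k)) / (1 - q) = ?f3 k" for k
    proof -
      define x where "x = (q^2)^k"
      have y: "1 - x/q \<noteq> 0" "1 - q*x \<noteq> 0"
        using nzi[of k] nz1[of k] by (simp_all add: x_def)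
      have xx: "(q^4)^k = x^2"
        by (simp add: x_def mult.commute flip: power_mult)
      have z: "1 - q^4*x^2 \<noteq> 0"
        using nz44[of k] by (simp add: xx)
      have P: "P_poly k q = q*x^6 - 3*q^2*x^5 + 3*(2*q^2 - 1)*q*x^4 - (3*q^4 - 1)*x^3
          + 3*q*x^2 - 3*q^2*x + 2*q^3 - q"
      proof -
        have "q^(12*k+1) = x^6 * q" "q^(10*k+2) = x^5 * q^2" "q^(8*k+1) = x^4 * q" "q^(6*k) = x^3"
          "q^(4*k+1) = x^2 * q" "q^(2*k+2) = x * q^2"
          by (simp_all add: x_def power_add mult.commute flip: power_mult) (simp_all add: power2_eq_square)
        then show ?thesis
          unfolding P_poly_def by (simp only: mult_ac)
      qed
      have hS: "h (Suc k) = h k * (q*x * (1 - q*x)^2 * (1 - q^2*x^2)) / (1 - q^4*x^2)^3"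
        unfolding h q_poch_Suc sq xx x_def[symmetric] power_mult_distrib
        by (simp add: mult_ac)
      have DS: "D (Suc k) = h k * x * (1 - q^2*x^2)"
      proof -
        have "1 - ((q^2)^Suc k)^2 = 1 - q^4*x^2" "1 - (q^2)^Suc k / q = 1 - q*x"
          using q0 by (simp_all add: x_def power_mult_distrib power2_eq_square eval_nat_numeral)
        then show ?thesis
          unfolding D_def hS using z y q0 by simp
      qed
      \<comment> \<open>After multiplication by (q - x)^2 this is the polynomial identity that
        explains \<open>P_poly\<close>: it is the combined numerator of the product-case term and
        the difference of \<open>D\<close>.\<close>
      have cert: "2*q*(1 - q*x^3) + x*(1 - q^2*x^2) - (1 - x^2)^3 / (q*(1 - x/q)^2)
          = P_poly k q / (q * (1 - x/q))^2"
      proof -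
        have u: "q * (1 - x/q) = q - x"
          using q0 by (simp add: field_simps)
        have v: "q - x \<noteq> 0"
          using y(1) q0 by (simp flip: u)
        have "q*(1 - x/q)^2 = (q - x)^2 / q"
          using q0 by (simp add: power2_eq_square field_simps)
        moreover have "(2*q*(1 - q*x^3) + x*(1 - q^2*x^2)) * (q - x)^2 - (1 - x^2)^3 * q = P_poly k q"
          unfolding P by algebra
        ultimately show ?thesis
          unfolding u using v by (simp add: field_simps)
      qed
      have "2 * q * quad_term q q (q^2) k + (D (Suc k) - D k) = P_poly k q / (q * (1 - x/q))^2 * h k"
        unfolding cert[symmetric] t DS unfolding D_def x_def[symmetric] by (simp add: algebra_simps)
      moreover have "(1 - q)^3 * (q_number (2*k) q - 1)^2 = (1 - q) * (q * (1 - x/q))^2"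
        unfolding num2 x_def[symmetric] using q1 by (simp add: power2_eq_square power3_eq_cube mult_ac)
      ultimately show ?thesis
        unfolding h by (simp add: mult_ac)
    qed
    ultimately show ?thesis
      by (simp only:)
  qed

  let ?f4 = "\<lambda>k. q_number (3*k + 4) q / q_number (2*k + 3) q ^ 2
          * (q_poch q q k ^ 3 * q_poch (-q) q k / q_poch (q^3) (q^2) k ^ 3)
          * q ^ (k * (k + 5) div 2)"
  \<comment> \<open>The case A = q^3, u = q. Two of the three denominator factorials start at q^5;
    bringing them back to q^3 creates [2k+3]_q^2 and the constant (1 - q^3)^2.\<close>
  have f4: "?f4 k = (1 - q) / (1 - q^3)^2 * quad_term (q^3) q q k" for k
  proof -
    define y where "y = q^3 * (q^2)^k"
    \<comment> \<open>The exponent is 3n + n(n-1)/2. The halving is exact: the numerator grows by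
      the even amount 2(3 + n).\<close>
    have w: "quad_weight (q^3) q n = q ^ (n * (n + 5) div 2)" for n
    proof (induction n)
      case (Suc n)
      have "Suc n * (Suc n + 5) = n * (n + 5) + 2 * (3 + n)"
        by (simp add: algebra_simps)
      then have "Suc n * (Suc n + 5) div 2 = n * (n + 5) div 2 + (3 + n)"
        using div_mult_self2[of 2 "n * (n + 5)" "3 + n"] by (simp only:)
      then show ?case
        using Suc by (simp add: quad_weight_def power_add)
    qed (simp add: quad_weight_def)
    have e: "q^3 * q * q = q^3 * q^2" "q^2 * q = q^3"
      by (simp_all add: eval_nat_numeral)
    have y: "1 - y \<noteq> 0" "1 - q^3 \<noteq> 0"
      using nz3[of k] nz3[of 0] by (simp_all add: y_def)
    have "(1 - q^3) * q_poch (q^3 * q^2) (q^2) k = q_poch (q^3) (q^2) k * (1 - y)"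
      unfolding q_poch_shift y_def ..
    then have s: "q_poch (q^3 * q^2) (q^2) k = q_poch (q^3) (q^2) k * (1 - y) / (1 - q^3)"
      using y by (simp add: field_simps)
    have "q^3 * q^2 * q^(3*k) / q = q^(3*k + 4)"
      using q0 by (simp add: power_add eval_nat_numeral)
    then have "quad_term (q^3) q q k = (1 - q^(3*k+4)) * (q ^ (k * (k + 5) div 2)
        * (q_poch q q k ^ 2 * (q_poch q q k * q_poch (-q) q k)
          / (q_poch (q^3) (q^2) k * (q_poch (q^3) (q^2) k * (1 - y) / (1 - q^3))^2)))"
      unfolding quad_term_def quad_coeff_def w e s q_poch_square_base by simp
    moreover have "q_number (3*k + 4) q / q_number (2*k + 3) q ^ 2 = (1 - q) * (1 - q^(3*k+4)) / (1 - y)^2"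
    proof -
      have "q ^ (2*k + 3) = y"
        by (simp add: y_def power_add power_mult)
      then show ?thesis
        unfolding q_number_def using q1 by (simp add: power2_eq_square)
    qed
    ultimately show ?thesis
      using y by (simp add: power2_eq_square power3_eq_cube mult_ac)
  qed
  have id4: "summable ?f4"
    and id5: "q * (\<Sum>k. ?f4 k) = (1 - q) ^ 2 * (q_poch_inf (q^2) (q^2) ^ 4 / q_poch_inf q (q^2) ^ 4) - 1 - q"
  proof -
    let ?S = "\<Sum>k. quad_term (q^3) q q k"
    let ?psi = "q_poch_inf (q^2) (q^2) ^ 4 / q_poch_inf q (q^2) ^ 4"
    let ?g = "\<lambda>n. (1 + q * (q^2)^n) * q^n / (1 - q * (q^2)^n)^2"
    note lam = quad_sums_lambert[OF q0 q nz3]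
    show "summable ?f4"
      unfolding f4 using lam(1) by (rule summable_mult)
    \<comment> \<open>For A = q^3 the Lambert series is the psi series from n = 1 on, up to the
      factor q(1 - q). The omitted term (1 + q)/(1 - q)^2 becomes the -1 - q of the result.\<close>
    have "(\<lambda>n. ?g (Suc n)) sums (?psi - ?g 0)"
      using psi_fourth_power_sums[OF q0 q] by (subst sums_Suc_iff) simp
    then have "(\<lambda>n. (1 - q) * ?g (Suc n)) sums ((1 - q) * (?psi - ?g 0))"
      by (rule sums_mult)
    moreover have "(\<lambda>n. q * ((1 - q) * (1 + q^3 * (q^2)^n) * q^n / (1 - q^3 * (q^2)^n)^2)) sums (q * (?S / (1 - q^3)^2))"
      using lam(2) by (rule sums_mult)
    moreover have "(1 - q) * ?g (Suc n) = q * ((1 - q) * (1 + q^3 * (q^2)^n) * q^n / (1 - q^3 * (q^2)^n)^2)" for n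
    proof -
      have "q * (q^2)^Suc n = q^3 * (q^2)^n"
        by (simp add: eval_nat_numeral mult_ac)
      then show ?thesis
        by (simp only: power_Suc) simp
    qed
    ultimately have lam_sum: "q * (?S / (1 - q^3)^2) = (1 - q) * (?psi - ?g 0)"
      using sums_unique2 by simp
    have "(\<Sum>k. ?f4 k) = (1 - q) / (1 - q^3)^2 * ?S"
      unfolding f4 using lam(1) by (rule suminf_mult)
    then have "q * (\<Sum>k. ?f4 k) = q * ((1 - q) / (1 - q^3)^2 * ?S)"
      by (rule arg_cong)
    also have "\<dots> = (1 - q) * (q * (?S / (1 - q^3)^2))"
      by simp
    also have "\<dots> = (1 - q) * ((1 - q) * (?psi - ?g 0))"
      unfolding lam_sum ..
    also have "\<dots> = (1 - q)^2 * ?psi - (1 - q)^2 * ?g 0"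
      by algebra
    also have "(1 - q)^2 * ?g 0 = 1 + q"
      using q1 by simp
    finally show "q * (\<Sum>k. ?f4 k) = (1 - q) ^ 2 * ?psi - 1 - q"
      by (simp only: diff_diff_eq)
  qed
  show ?thesis
    by (intro conjI id1 id2 id3 id4 id5)
qed

end
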